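(* Let $G=(X,b,m)$ be a connected, locally finite weighted graph with Laplacian $\Delta$. If $\Delta$ is a bounded operator on $\ell^2(X,m)$, then $G$ is Feller.
   Context: Weighted graph: $G=(X,b,m)$ where $X$ is a countably infinite set (vertices), $b:X\times X\to[0,\infty)$ satisfies $b(x,y)=b(y,x)$, $b(x,x)=0$ and $|\{y : b(x,y)>0\}|<\infty$ for all $x$ (local finiteness), and $m:X\to(0,\infty)$ is a vertex measure. Write $x\sim y$ if $b(x,y)>0$. $G$ is connected if any two vertices are joined by a finite path $x=x_0\sim x_1\sim\dots\sim x_n=y$. Laplacian and heat semigroup: the formal Laplacian is $\widetilde\Delta f(x)=\frac1{m(x)}\sum_{y\in X}b(x,y)(f(x)-f(y))$ for $f:X\to\mathbb{R}$. $C_c(X)$ is the space of finitely supported real functions, and $\ell^2(X,m)$ is the Hilbert space of real functions with $\sum_x f(x)^2m(x)<\infty$, with inner product $\langle f,g\rangle=\sum_x f(x)g(x)m(x)$. $\Delta$ is the Friedrichs extension in $\ell^2(X,m)$ of $\widetilde\Delta|_{C_c(X)}$, i.e. the self-adjoint operator of the closure of the form $\frac12\sum_{x,y}b(x,y)(f(x)-f(y))(g(x)-g(y))$ on $C_c(X)$. The semigroup $P_t=e^{-t\Delta}$ has a heat kernel $p_t(x,y)\ge 0$ and acts on bounded functions by $P_tf(x)=\sum_{y\in X}p_t(x,y)f(y)m(y)$. Feller: $C_0(X)$ is the space of functions vanishing at infinity, i.e. the closure of $C_c(X)$ in the sup norm. $G$ is Feller if $P_t$ maps $C_0(X)$ into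 $C_0(X)$ for all $t\ge0$. *)

theory Defs
  imports "HOL-Analysis.Analysis"
begin

text \<open>The vertex set is the whole type \<open>'v\<close>; a weighted graph requires it to be countably infinite.\<close>

definition locally_finite :: "('v \<Rightarrow> 'v \<Rightarrow> real) \<Rightarrow> bool" where
  "locally_finite b \<longleftrightarrow> (\<forall>x. finite {y. b x y > 0})"

definition weighted_graph :: "('v \<Rightarrow> 'v \<Rightarrow> real) \<Rightarrow> ('v \<Rightarrow> real) \<Rightarrow> bool" where
  "weighted_graph b m \<longleftrightarrow>
     countable (UNIV :: 'v set) \<and> infinite (UNIV :: 'v set) \<and>
     (\<forall>x y. b x y \<ge> 0) \<and> (\<forall>x y. b x y = b y x) \<and> (\<forall>x. b x x = 0) \<and>
     locally_finite b \<and> (\<forall>x. m x > 0)"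

definition connected_graph :: "('v \<Rightarrow> 'v \<Rightarrow> real) \<Rightarrow> bool" where
  "connected_graph b \<longleftrightarrow> (\<forall>x y. (\<lambda>u v. b u v > 0)\<^sup>*\<^sup>* x y)"

definition Cc :: "('v \<Rightarrow> real) set" where
  "Cc = {f. finite {x. f x \<noteq> 0}}"

definition l2 :: "('v \<Rightarrow> real) \<Rightarrow> ('v \<Rightarrow> real) set" where
  "l2 m = {f. (\<lambda>x. (f x)\<^sup>2 * m x) summable_on UNIV}"

definition l2_inner :: "('v \<Rightarrow> real) \<Rightarrow> ('v \<Rightarrow> real) \<Rightarrow> ('v \<Rightarrow> real) \<Rightarrow> real" where
  "l2_inner m f g = (\<Sum>\<^sub>\<infinity>x. f x * g x * m x)"

text \<open>Outside \<open>l2 m\<close> the value of the norm is meaningless (a divergent \<open>infsum\<close> is 0);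
  below it is only applied to elements of \<open>l2 m\<close>.\<close>

definition l2_norm :: "('v \<Rightarrow> real) \<Rightarrow> ('v \<Rightarrow> real) \<Rightarrow> real" where
  "l2_norm m f = sqrt (l2_inner m f f)"

definition energy :: "('v \<Rightarrow> 'v \<Rightarrow> real) \<Rightarrow> ('v \<Rightarrow> real) \<Rightarrow> ('v \<Rightarrow> real) \<Rightarrow> real" where
  "energy b f g = 1/2 * (\<Sum>\<^sub>\<infinity>(x, y)\<in>UNIV. b x y * (f x - f y) * (g x - g y))"

text \<open>Closure of the form \<open>energy b\<close> on \<open>Cc\<close>: the domain consists of the \<open>l2\<close>-limits of sequences
  in \<open>Cc\<close> that are Cauchy with respect to the form, and the form is extended by continuity along
  such sequences. The form is closable, so the limit does not depend on the sequences.\<close>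

definition form_approx ::
  "('v \<Rightarrow> 'v \<Rightarrow> real) \<Rightarrow> ('v \<Rightarrow> real) \<Rightarrow> (nat \<Rightarrow> 'v \<Rightarrow> real) \<Rightarrow> ('v \<Rightarrow> real) \<Rightarrow> bool" where
  "form_approx b m \<phi> f \<longleftrightarrow>
     (\<forall>n. \<phi> n \<in> Cc) \<and> f \<in> l2 m \<and>
     (\<lambda>n. l2_norm m (\<lambda>x. \<phi> n x - f x)) \<longlonglongrightarrow> 0 \<and>
     (\<forall>\<epsilon>>0. \<exists>N. \<forall>i\<ge>N. \<forall>j\<ge>N.
        energy b (\<lambda>x. \<phi> i x - \<phi> j x) (\<lambda>x. \<phi> i x - \<phi> j x) < \<epsilon>)"

definition form_domain :: "('v \<Rightarrow> 'v \<Rightarrow> real) \<Rightarrow> ('v \<Rightarrow> real) \<Rightarrow> ('v \<Rightarrow> real) set" where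
  "form_domain b m = {f. \<exists>\<phi>. form_approx b m \<phi> f}"

definition form_closure ::
  "('v \<Rightarrow> 'v \<Rightarrow> real) \<Rightarrow> ('v \<Rightarrow> real) \<Rightarrow> ('v \<Rightarrow> real) \<Rightarrow> ('v \<Rightarrow> real) \<Rightarrow> real" where
  "form_closure b m f g =
     (THE q. \<forall>\<phi> \<psi>. form_approx b m \<phi> f \<longrightarrow> form_approx b m \<psi> g \<longrightarrow>
        (\<lambda>n. energy b (\<phi> n) (\<psi> n)) \<longlonglongrightarrow> q)"

text \<open>Operators in \<open>l2 m\<close>, possibly unbounded, are represented by their graphs. The Friedrichs
  extension is the operator associated with the closed form; on \<open>Cc\<close> it acts as
  \<open>formal_laplacian\<close>.\<close>

type_synonym 'v l2_operator = "(('v \<Rightarrow> real) \<times> ('v \<Rightarrow> real)) set"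

definition formal_laplacian ::
  "('v \<Rightarrow> 'v \<Rightarrow> real) \<Rightarrow> ('v \<Rightarrow> real) \<Rightarrow> ('v \<Rightarrow> real) \<Rightarrow> 'v \<Rightarrow> real" where
  "formal_laplacian b m f x = 1 / m x * (\<Sum>\<^sub>\<infinity>y. b x y * (f x - f y))"

definition laplacian :: "('v \<Rightarrow> 'v \<Rightarrow> real) \<Rightarrow> ('v \<Rightarrow> real) \<Rightarrow> 'v l2_operator" where
  "laplacian b m =
     {(f, h). f \<in> form_domain b m \<and> h \<in> l2 m \<and>
        (\<forall>g \<in> form_domain b m. form_closure b m f g = l2_inner m h g)}"

definition bounded_l2_operator :: "('v \<Rightarrow> real) \<Rightarrow> 'v l2_operator \<Rightarrow> bool" where
  "bounded_l2_operator m A \<longleftrightarrow>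
     Domain A = l2 m \<and> (\<exists>C. \<forall>(f, h)\<in>A. l2_norm m h \<le> C * l2_norm m f)"

text \<open>The semigroup \<open>e\<^bsup>-tA\<^esup>\<close> of a nonnegative self-adjoint operator \<open>A\<close> is the strongly continuous
  semigroup of bounded operators with generator \<open>-A\<close>. It is determined only for \<open>t \<ge> 0\<close> and on
  \<open>l2 m\<close>.\<close>

definition C0_semigroup :: "('v \<Rightarrow> real) \<Rightarrow> (real \<Rightarrow> ('v \<Rightarrow> real) \<Rightarrow> ('v \<Rightarrow> real)) \<Rightarrow> bool" where
  "C0_semigroup m T \<longleftrightarrow>
     (\<forall>t\<ge>0. \<forall>f\<in>l2 m. T t f \<in> l2 m) \<and>
     (\<forall>t\<ge>0. \<forall>f\<in>l2 m. \<forall>g\<in>l2 m. \<forall>c d.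
        T t (\<lambda>x. c * f x + d * g x) = (\<lambda>x. c * T t f x + d * T t g x)) \<and>
     (\<forall>t\<ge>0. \<exists>C. \<forall>f\<in>l2 m. l2_norm m (T t f) \<le> C * l2_norm m f) \<and>
     (\<forall>f\<in>l2 m. T 0 f = f) \<and>
     (\<forall>s\<ge>0. \<forall>t\<ge>0. \<forall>f\<in>l2 m. T (s + t) f = T s (T t f)) \<and>
     (\<forall>f\<in>l2 m. ((\<lambda>t. l2_norm m (\<lambda>x. T t f x - f x)) \<longlongrightarrow> 0) (at_right 0))"

definition generator ::
  "('v \<Rightarrow> real) \<Rightarrow> (real \<Rightarrow> ('v \<Rightarrow> real) \<Rightarrow> ('v \<Rightarrow> real)) \<Rightarrow> 'v l2_operator" where
  "generator m T =
     {(f, h). f \<in> l2 m \<and> h \<in> l2 m \<and>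
        ((\<lambda>t. l2_norm m (\<lambda>x. (T t f x - f x) / t - h x)) \<longlongrightarrow> 0) (at_right 0)}"

definition exp_semigroup ::
  "('v \<Rightarrow> real) \<Rightarrow> 'v l2_operator \<Rightarrow> real \<Rightarrow> ('v \<Rightarrow> real) \<Rightarrow> ('v \<Rightarrow> real)" where
  "exp_semigroup m A t f =
     (THE u. \<exists>T. C0_semigroup m T \<and> generator m T = {(g, \<lambda>x. - h x) | g h. (g, h) \<in> A} \<and>
        u = T t f)"

text \<open>The heat kernel is defined by \<open>P\<^sub>t f(x) = \<Sum>\<^sub>y p\<^sub>t(x,y) f(y) m(y)\<close> for \<open>f\<close> in \<open>l2 m\<close>; taking \<open>f\<close>
  to be the indicator function of \<open>{y}\<close> gives the following formula.\<close>

definition heat_kernel ::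
  "('v \<Rightarrow> 'v \<Rightarrow> real) \<Rightarrow> ('v \<Rightarrow> real) \<Rightarrow> real \<Rightarrow> 'v \<Rightarrow> 'v \<Rightarrow> real" where
  "heat_kernel b m t x y = exp_semigroup m (laplacian b m) t (indicator {y}) x / m y"

definition heat_semigroup ::
  "('v \<Rightarrow> 'v \<Rightarrow> real) \<Rightarrow> ('v \<Rightarrow> real) \<Rightarrow> real \<Rightarrow> ('v \<Rightarrow> real) \<Rightarrow> ('v \<Rightarrow> real)" where
  "heat_semigroup b m t f x = (\<Sum>\<^sub>\<infinity>y. heat_kernel b m t x y * f y * m y)"

definition C0 :: "('v \<Rightarrow> real) set" where
  "C0 = {f. \<forall>\<epsilon>>0. \<exists>g\<in>Cc. \<forall>x. \<bar>f x - g x\<bar> \<le> \<epsilon>}"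

definition feller :: "('v \<Rightarrow> 'v \<Rightarrow> real) \<Rightarrow> ('v \<Rightarrow> real) \<Rightarrow> bool" where
  "feller b m \<longleftrightarrow> (\<forall>t\<ge>0. \<forall>f\<in>C0. heat_semigroup b m t f \<in> C0)"

end

theory Submission
  imports Defs
begin

text \<open>Boundedness on \<open>l2 m\<close> bounds the Laplacian in the supremum norm as well, and this is what makes
  the heat semigroup preserve functions vanishing at infinity.

  Closability of the energy form shows that the Friedrichs extension acts as the formal Laplacian \<open>L\<close>
  on its whole domain (\<open>form_closable\<close>, \<open>laplacian_formal\<close>). When it is bounded, evaluating \<open>L\<close> on
  the indicator function of \<open>x\<close> gives \<open>deg x \<le> M * m x\<close> for the weighted degree (\<open>degree_le\<close>), hence
  \<open>\<bar>L f\<bar> \<le> 2 M sup \<bar>f\<bar>\<close>. Moreover \<open>L\<close> preserves finite supports, because the graph is locally finite.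
  So the series \<open>\<Sum>k. (-t)\<^sup>k L\<^sup>k f / k!\<close> of a finitely supported \<open>f\<close> converges uniformly with finitely
  supported partial sums, and its sum vanishes at infinity (\<open>operator_exp_Cc_C0\<close>). Its rows are
  absolutely summable with a common bound (\<open>operator_exp_row_sum_le\<close>), so the conclusion extends from
  \<open>Cc\<close> to its uniform closure \<open>C0\<close>.

  It remains to see that this series is the semigroup that defines the heat kernel
  (\<open>exp_semigroup_eq_operator_exp\<close>). On \<open>l2 m\<close> the series is a strongly continuous semigroup with
  generator \<open>-L\<close>. It is the only one: any other one is bounded near time \<open>0\<close> by the uniform boundedness
  principle and commutes with \<open>L\<close>, and splitting \<open>[0, t]\<close> into \<open>n\<close> equal steps bounds the difference
  by \<open>n\<close> times a quantity that is \<open>o(1/n)\<close>.\<close>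

section \<open>Weighted sequence spaces\<close>

text \<open>A weight may vanish here, so that the results apply both to a vertex measure and to the edge
  weight \<open>b\<close> on pairs of vertices, whose space carries the gradients of functions.\<close>

locale weight =
  fixes m :: "'v \<Rightarrow> real"
  assumes nonneg: "0 \<le> m x"
begin

text \<open>Everything about \<open>l2 m\<close> is reduced to finite sums through this criterion: the triangle and
  Cauchy-Schwarz inequalities for \<open>L2_set\<close> pass to the supremum over finite sets.\<close>

lemma l2_iff_L2_set_bounded:
  "f \<in> l2 m \<and> l2_norm m f \<le> B \<longleftrightarrow>
     0 \<le> B \<and> (\<forall>F. finite F \<longrightarrow> L2_set (\<lambda>x. f x * sqrt (m x)) F \<le> B)" (is "?L \<longleftrightarrow> ?R")
proof -
  have L2: "L2_set (\<lambda>x. f x * sqrt (m x)) F = sqrt (\<Sum>x\<in>F. (f x)\<^sup>2 * m x)" for F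
    by (simp add: L2_set_def power_mult_distrib nonneg)
  have norm: "l2_norm m f = sqrt (\<Sum>\<^sub>\<infinity>x. (f x)\<^sup>2 * m x)"
    by (simp add: l2_norm_def l2_inner_def power2_eq_square)
  have pos: "0 \<le> (f x)\<^sup>2 * m x" for x
    by (simp add: nonneg)
  show ?thesis
  proof
    assume ?L
    then have s: "(\<lambda>x. (f x)\<^sup>2 * m x) summable_on UNIV" and B: "sqrt (\<Sum>\<^sub>\<infinity>x. (f x)\<^sup>2 * m x) \<le> B"
      by (auto simp: l2_def norm)
    have "0 \<le> (\<Sum>\<^sub>\<infinity>x. (f x)\<^sup>2 * m x)"
      by (rule infsum_nonneg) (simp add: pos)
    moreover have "sqrt (\<Sum>x\<in>F. (f x)\<^sup>2 * m x) \<le> B" if "finite F" for F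
    proof -
      have "(\<Sum>x\<in>F. (f x)\<^sup>2 * m x) \<le> (\<Sum>\<^sub>\<infinity>x. (f x)\<^sup>2 * m x)"
        by (rule finite_sum_le_infsum) (use s that pos in auto)
      with B show ?thesis
        using real_sqrt_le_mono order_trans by blast
    qed
    ultimately show ?R
      using B real_sqrt_ge_zero L2 by (metis order_trans)
  next
    assume R: ?R
    have le: "(\<Sum>x\<in>F. (f x)\<^sup>2 * m x) \<le> B\<^sup>2" if "finite F" for F
      using R that L2[of F] by (metis sqrt_le_D)
    have s: "(\<lambda>x. (f x)\<^sup>2 * m x) summable_on UNIV"
      by (rule nonneg_bdd_above_summable_on) (use le pos in \<open>auto intro!: bdd_aboveI2\<close>)
    have "(\<Sum>\<^sub>\<infinity>x. (f x)\<^sup>2 * m x) \<le> B\<^sup>2"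
      by (rule infsum_le_finite_sums) (use s le in auto)
    then show ?L
      using s R by (auto simp: l2_def norm intro: real_le_lsqrt)
  qed
qed

lemma L2_set_le_l2_norm:
  assumes "f \<in> l2 m" "finite F"
  shows "L2_set (\<lambda>x. f x * sqrt (m x)) F \<le> l2_norm m f"
  using l2_iff_L2_set_bounded[of f "l2_norm m f"] assms by simp

lemma l2_norm_nonneg: "f \<in> l2 m \<Longrightarrow> 0 \<le> l2_norm m f"
  using l2_iff_L2_set_bounded[of f "l2_norm m f"] by simp

lemma l2_I:
  assumes "0 \<le> B" "\<And>F. finite F \<Longrightarrow> L2_set (\<lambda>x. f x * sqrt (m x)) F \<le> B"
  shows "f \<in> l2 m" "l2_norm m f \<le> B"
  using l2_iff_L2_set_bounded[of f B] assms by auto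

lemma l2_zero: "(\<lambda>x. 0) \<in> l2 m" "l2_norm m (\<lambda>x. 0) = 0"
  by (auto simp: l2_def l2_norm_def l2_inner_def)

lemma l2_norm_uminus: "l2_norm m (\<lambda>x. - f x) = l2_norm m f"
  by (simp add: l2_norm_def l2_inner_def)

lemma l2_add:
  assumes "f \<in> l2 m" "g \<in> l2 m"
  shows "(\<lambda>x. f x + g x) \<in> l2 m" "l2_norm m (\<lambda>x. f x + g x) \<le> l2_norm m f + l2_norm m g"
proof -
  have "L2_set (\<lambda>x. (f x + g x) * sqrt (m x)) F \<le> l2_norm m f + l2_norm m g" if "finite F" for F
    using L2_set_triangle_ineq[of "\<lambda>x. f x * sqrt (m x)" "\<lambda>x. g x * sqrt (m x)" F]
      L2_set_le_l2_norm[OF assms(1) that] L2_set_le_l2_norm[OF assms(2) that]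
    by (simp add: distrib_right)
  then show "(\<lambda>x. f x + g x) \<in> l2 m" "l2_norm m (\<lambda>x. f x + g x) \<le> l2_norm m f + l2_norm m g"
    using l2_I[of "l2_norm m f + l2_norm m g" "\<lambda>x. f x + g x"] l2_norm_nonneg assms by auto
qed

lemma l2_scale:
  assumes "f \<in> l2 m"
  shows "(\<lambda>x. c * f x) \<in> l2 m" "l2_norm m (\<lambda>x. c * f x) = \<bar>c\<bar> * l2_norm m f"
proof -
  show "(\<lambda>x. c * f x) \<in> l2 m"
    using assms by (auto simp: l2_def power_mult_distrib mult.assoc intro: summable_on_cmult_right)
  have "(\<Sum>\<^sub>\<infinity>x. c\<^sup>2 * ((f x)\<^sup>2 * m x)) = c\<^sup>2 * (\<Sum>\<^sub>\<infinity>x. (f x)\<^sup>2 * m x)"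
    by (rule infsum_cmult_right')
  then show "l2_norm m (\<lambda>x. c * f x) = \<bar>c\<bar> * l2_norm m f"
    by (simp add: l2_norm_def l2_inner_def power2_eq_square real_sqrt_mult algebra_simps)
qed

lemma l2_diff:
  assumes "f \<in> l2 m" "g \<in> l2 m"
  shows "(\<lambda>x. f x - g x) \<in> l2 m" "l2_norm m (\<lambda>x. f x - g x) \<le> l2_norm m f + l2_norm m g"
  using l2_add[OF assms(1) l2_scale(1)[OF assms(2), of "-1"]] l2_norm_uminus[of g] by auto

lemma l2_norm_triangle:
  assumes "f \<in> l2 m" "g \<in> l2 m" "h \<in> l2 m"
  shows "l2_norm m (\<lambda>x. f x - h x) \<le> l2_norm m (\<lambda>x. f x - g x) + l2_norm m (\<lambda>x. g x - h x)"
  using l2_add(2)[OF l2_diff(1)[OF assms(1,2)] l2_diff(1)[OF assms(2,3)]] by simp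

lemma l2_norm_minus_commute: "l2_norm m (\<lambda>x. f x - g x) = l2_norm m (\<lambda>x. g x - f x)"
  using l2_norm_uminus[of "\<lambda>x. f x - g x"] by simp

lemma l2_norm_diff_ge:
  assumes "f \<in> l2 m" "g \<in> l2 m"
  shows "l2_norm m f - l2_norm m g \<le> l2_norm m (\<lambda>x. f x - g x)"
  using l2_add(2)[OF l2_diff(1)[OF assms] assms(2)] by simp

lemma l2_sum:
  assumes "finite I" "\<And>i. i \<in> I \<Longrightarrow> g i \<in> l2 m"
  shows "(\<lambda>x. \<Sum>i\<in>I. g i x) \<in> l2 m"
    and "l2_norm m (\<lambda>x. \<Sum>i\<in>I. g i x) \<le> (\<Sum>i\<in>I. l2_norm m (g i))"
proof -
  have "(\<lambda>x. \<Sum>i\<in>I. g i x) \<in> l2 m \<and> l2_norm m (\<lambda>x. \<Sum>i\<in>I. g i x) \<le> (\<Sum>i\<in>I. l2_norm m (g i))"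
    using assms
  proof (induction I rule: finite_induct)
    case empty
    then show ?case by (simp add: l2_zero)
  next
    case (insert i I)
    then show ?case
      using l2_add[of "g i" "\<lambda>x. \<Sum>i\<in>I. g i x"] by force
  qed
  then show "(\<lambda>x. \<Sum>i\<in>I. g i x) \<in> l2 m"
    and "l2_norm m (\<lambda>x. \<Sum>i\<in>I. g i x) \<le> (\<Sum>i\<in>I. l2_norm m (g i))"
    by auto
qed

text \<open>A bound on the norms survives pointwise limits, because each of the finite sums that make up
  the norm depends continuously on finitely many values. This replaces completeness of \<open>l2 m\<close>: it
  gives both the convergence of series below and the closability of the Dirichlet form.\<close>

lemma l2_Fatou:
  assumes "\<And>x. (\<lambda>n. g n x) \<longlonglongrightarrow> f x"
    and "eventually (\<lambda>n. g n \<in> l2 m \<and> l2_norm m (g n) \<le> B) sequentially"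
  shows "f \<in> l2 m" "l2_norm m f \<le> B"
proof -
  have "0 \<le> B"
  proof -
    obtain n where "g n \<in> l2 m" "l2_norm m (g n) \<le> B"
      using eventually_happens[OF assms(2)] by auto
    then show ?thesis
      using l2_norm_nonneg[of "g n"] by simp
  qed
  moreover have "L2_set (\<lambda>x. f x * sqrt (m x)) F \<le> B" if "finite F" for F
  proof (rule tendsto_upperbound)
    show "(\<lambda>n. L2_set (\<lambda>x. g n x * sqrt (m x)) F) \<longlonglongrightarrow> L2_set (\<lambda>x. f x * sqrt (m x)) F"
      unfolding L2_set_def by (intro tendsto_intros assms(1))
    show "eventually (\<lambda>n. L2_set (\<lambda>x. g n x * sqrt (m x)) F \<le> B) sequentially"
      using assms(2)
    proof eventually_elim
      case (elim n)
      then show ?case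
        using L2_set_le_l2_norm[of "g n" F] that by simp
    qed
  qed simp
  ultimately show "f \<in> l2 m" "l2_norm m f \<le> B"
    using l2_I by auto
qed

lemma l2_Cauchy_Schwarz:
  assumes "f \<in> l2 m" "g \<in> l2 m"
  shows "(\<lambda>x. f x * g x * m x) summable_on UNIV"
    and "\<bar>l2_inner m f g\<bar> \<le> l2_norm m f * l2_norm m g"
proof -
  have le: "(\<Sum>x\<in>F. norm (f x * g x * m x)) \<le> l2_norm m f * l2_norm m g" if "finite F" for F
  proof -
    have "(\<Sum>x\<in>F. norm (f x * g x * m x)) = (\<Sum>x\<in>F. \<bar>f x * sqrt (m x)\<bar> * \<bar>g x * sqrt (m x)\<bar>)"
      using nonneg by (intro sum.cong) (auto simp: abs_mult algebra_simps)
    also have "\<dots> \<le> L2_set (\<lambda>x. f x * sqrt (m x)) F * L2_set (\<lambda>x. g x * sqrt (m x)) F"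
      by (rule L2_set_mult_ineq)
    also have "\<dots> \<le> l2_norm m f * l2_norm m g"
      using assms that by (intro mult_mono L2_set_le_l2_norm l2_norm_nonneg L2_set_nonneg) auto
    finally show ?thesis .
  qed
  have abs: "(\<lambda>x. norm (f x * g x * m x)) summable_on UNIV"
    by (rule nonneg_bdd_above_summable_on) (use le in \<open>auto intro!: bdd_aboveI2\<close>)
  then show "(\<lambda>x. f x * g x * m x) summable_on UNIV"
    by (rule abs_summable_summable)
  have "\<bar>l2_inner m f g\<bar> \<le> (\<Sum>\<^sub>\<infinity>x. norm (f x * g x * m x))"
    unfolding l2_inner_def using norm_infsum_bound[OF abs] by simp
  also have "\<dots> \<le> l2_norm m f * l2_norm m g"
    by (rule infsum_le_finite_sums) (use abs le in auto)
  finally show "\<bar>l2_inner m f g\<bar> \<le> l2_norm m f * l2_norm m g" .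
qed

lemma l2_inner_diff_right:
  assumes "f \<in> l2 m" "g \<in> l2 m" "h \<in> l2 m"
  shows "l2_inner m f (\<lambda>x. g x - h x) = l2_inner m f g - l2_inner m f h"
proof -
  have "l2_inner m f (\<lambda>x. g x - h x) = (\<Sum>\<^sub>\<infinity>x. f x * g x * m x + - (f x * h x * m x))"
    unfolding l2_inner_def by (simp add: algebra_simps)
  also have "\<dots> = l2_inner m f g + (\<Sum>\<^sub>\<infinity>x. - (f x * h x * m x))"
    unfolding l2_inner_def using l2_Cauchy_Schwarz(1) assms
    by (intro infsum_add) (auto simp: summable_on_uminus)
  also have "\<dots> = l2_inner m f g - l2_inner m f h"
    unfolding l2_inner_def by (simp add: infsum_uminus)
  finally show ?thesis .
qed

end

locale positive_weight =
  fixes m :: "'v \<Rightarrow> real"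
  assumes pos: "0 < m x"

sublocale positive_weight \<subseteq> weight
  by unfold_locales (simp add: pos less_imp_le)

context positive_weight
begin

lemma abs_le_l2_norm:
  assumes "f \<in> l2 m"
  shows "\<bar>f x\<bar> \<le> l2_norm m f / sqrt (m x)"
proof -
  have "\<bar>f x\<bar> * sqrt (m x) \<le> l2_norm m f"
    using L2_set_le_l2_norm[OF assms, of "{x}"] pos[of x] by (simp add: abs_mult)
  then show ?thesis
    using pos[of x] by (simp add: pos_le_divide_eq)
qed

lemma l2_norm_tendsto_pointwise:
  assumes "\<And>n. g n \<in> l2 m" "f \<in> l2 m" "((\<lambda>n. l2_norm m (\<lambda>x. g n x - f x)) \<longlongrightarrow> 0) F"
  shows "((\<lambda>n. g n x) \<longlongrightarrow> f x) F"
proof -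
  have "((\<lambda>n. g n x - f x) \<longlongrightarrow> 0) F"
  proof (rule Lim_null_comparison)
    show "\<forall>\<^sub>F n in F. norm (g n x - f x) \<le> l2_norm m (\<lambda>x. g n x - f x) / sqrt (m x)"
      using abs_le_l2_norm[OF l2_diff(1)[OF assms(1,2)]] by simp
    show "((\<lambda>n. l2_norm m (\<lambda>x. g n x - f x) / sqrt (m x)) \<longlongrightarrow> 0) F"
      using tendsto_divide_zero[OF assms(3)] by simp
  qed
  then show ?thesis
    by (rule LIM_zero_cancel)
qed

text \<open>The limit is stated for an arbitrary filter, since it serves for sequences and for difference
  quotients as \<open>t\<close> tends to \<open>0\<close> from the right.\<close>

lemma l2_norm_tendsto_unique:
  assumes "\<And>n. g n \<in> l2 m" "f \<in> l2 m" "h \<in> l2 m" "F \<noteq> bot"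
    and "((\<lambda>n. l2_norm m (\<lambda>x. g n x - f x)) \<longlongrightarrow> 0) F"
    and "((\<lambda>n. l2_norm m (\<lambda>x. g n x - h x)) \<longlongrightarrow> 0) F"
  shows "f = h"
proof
  fix x
  show "f x = h x"
  proof (rule tendsto_unique[OF assms(4)])
    show "((\<lambda>n. g n x) \<longlongrightarrow> f x) F"
      by (rule l2_norm_tendsto_pointwise) (use assms in auto)
    show "((\<lambda>n. g n x) \<longlongrightarrow> h x) F"
      by (rule l2_norm_tendsto_pointwise) (use assms in auto)
  qed
qed

lemma l2_norm_indicator:
  "(indicator {y} :: 'v \<Rightarrow> real) \<in> l2 m" "l2_norm m (indicator {y}) = sqrt (m y)"
proof -
  have eq: "(indicator {y} x :: real)\<^sup>2 * m x = (if x = y then m y else 0)" for x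
    by auto
  have h: "((\<lambda>x. (indicator {y} x :: real)\<^sup>2 * m x) has_sum m y) UNIV"
    unfolding eq by (rule has_sum_finite_neutralI[where B = "{y}"]) auto
  then show "(indicator {y} :: 'v \<Rightarrow> real) \<in> l2 m"
    unfolding l2_def summable_on_def by blast
  show "l2_norm m (indicator {y}) = sqrt (m y)"
    using infsumI[OF h] by (simp add: l2_norm_def l2_inner_def power2_eq_square)
qed

lemma Cc_sum_indicator:
  fixes f :: "'v \<Rightarrow> real"
  assumes "f \<in> Cc"
  shows "f = (\<lambda>x. \<Sum>y | f y \<noteq> 0. f y * indicator {y} x)"
proof
  fix x
  have "(\<Sum>y | f y \<noteq> 0. f y * indicator {y} x) = (\<Sum>y | f y \<noteq> 0. if y = x then f y else 0)"
    by (intro sum.cong) (auto simp: indicator_def)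
  also have "\<dots> = f x"
    using assms by (simp add: Cc_def)
  finally show "f x = (\<Sum>y | f y \<noteq> 0. f y * indicator {y} x)" by simp
qed

lemma Cc_subset_l2: "Cc \<subseteq> l2 m"
proof
  fix f :: "'v \<Rightarrow> real"
  assume f: "f \<in> Cc"
  have "(\<lambda>x. \<Sum>y | f y \<noteq> 0. f y * indicator {y} x) \<in> l2 m"
    using f by (intro l2_sum l2_scale l2_norm_indicator) (auto simp: Cc_def)
  then show "f \<in> l2 m"
    using Cc_sum_indicator[OF f] by simp
qed

text \<open>A positive weight bounds each value by the norm, so the series converges pointwise; the
  Fatou property applied to the partial sums of its tails bounds the remainders in norm.\<close>

lemma l2_absolutely_convergent_series:
  assumes g: "\<And>k. g k \<in> l2 m" and s: "summable (\<lambda>k. l2_norm m (g k))"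
  shows "summable (\<lambda>k. g k x)"
    and "(\<lambda>x. \<Sum>k. g k x) \<in> l2 m"
    and "l2_norm m (\<lambda>x. (\<Sum>k. g k x) - (\<Sum>k<n. g k x)) \<le> (\<Sum>k. l2_norm m (g (k + n)))"
proof -
  show sx: "summable (\<lambda>k. g k x)" for x
  proof (rule summable_comparison_test')
    show "summable (\<lambda>k. l2_norm m (g k) / sqrt (m x))"
      using s by (rule summable_divide)
  qed (use abs_le_l2_norm[OF g] in simp)
  have tail: "(\<lambda>x. (\<Sum>k. g k x) - (\<Sum>k<n. g k x)) \<in> l2 m \<and>
    l2_norm m (\<lambda>x. (\<Sum>k. g k x) - (\<Sum>k<n. g k x)) \<le> (\<Sum>k. l2_norm m (g (k + n)))" for n
  proof -
    have le: "l2_norm m (\<lambda>x. \<Sum>k<N. g (k + n) x) \<le> (\<Sum>k. l2_norm m (g (k + n)))" for N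
    proof -
      have "l2_norm m (\<lambda>x. \<Sum>k<N. g (k + n) x) \<le> (\<Sum>k<N. l2_norm m (g (k + n)))"
        by (rule l2_sum) (use g in auto)
      also have "\<dots> \<le> (\<Sum>k. l2_norm m (g (k + n)))"
        by (rule sum_le_suminf) (use summable_ignore_initial_segment[OF s] g l2_norm_nonneg in auto)
      finally show ?thesis .
    qed
    have lim: "(\<lambda>N. \<Sum>k<N. g (k + n) x) \<longlonglongrightarrow> (\<Sum>k. g k x) - (\<Sum>k<n. g k x)" for x
      using summable_LIMSEQ[OF summable_ignore_initial_segment[OF sx, of n x]]
        suminf_minus_initial_segment[OF sx, of n x] by simp
    show ?thesis
    proof -
      have ev: "\<forall>\<^sub>F N in sequentially. (\<lambda>x. \<Sum>k<N. g (k + n) x) \<in> l2 m \<and>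
          l2_norm m (\<lambda>x. \<Sum>k<N. g (k + n) x) \<le> (\<Sum>k. l2_norm m (g (k + n)))"
        using le l2_sum(1)[of "{..<_}" "\<lambda>k. g (k + n)"] g by simp
      show ?thesis
        using l2_Fatou[OF lim ev] by blast
    qed
  qed
  then show "l2_norm m (\<lambda>x. (\<Sum>k. g k x) - (\<Sum>k<n. g k x)) \<le> (\<Sum>k. l2_norm m (g (k + n)))"
    by blast
  show "(\<lambda>x. \<Sum>k. g k x) \<in> l2 m"
    using tail[of 0] by simp
qed

lemma l2_series_tendsto:
  assumes g: "\<And>k. g k \<in> l2 m" and s: "summable (\<lambda>k. l2_norm m (g k))"
  shows "(\<lambda>n. l2_norm m (\<lambda>x. (\<Sum>k<n. g k x) - (\<Sum>k. g k x))) \<longlonglongrightarrow> 0"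
proof -
  have l2: "(\<lambda>x. (\<Sum>k<n. g k x) - (\<Sum>k. g k x)) \<in> l2 m" for n
    by (rule l2_diff(1)[OF l2_sum(1) l2_absolutely_convergent_series(2)]) (use g s in auto)
  have lim: "(\<lambda>n. \<Sum>k. l2_norm m (g (k + n))) \<longlonglongrightarrow> 0"
    using suminf_exist_split2[OF s] by simp
  have le: "l2_norm m (\<lambda>x. (\<Sum>k<n. g k x) - (\<Sum>k. g k x)) \<le> (\<Sum>k. l2_norm m (g (k + n)))" for n
    by (subst l2_norm_minus_commute) (rule l2_absolutely_convergent_series(3), use g s in auto)
  show ?thesis
    by (rule tendsto_sandwich[OF _ _ tendsto_const lim]) (use l2_norm_nonneg[OF l2] le in auto)
qed

end

section \<open>Exponentials of bounded operators\<close>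

text \<open>The bound is a parameter rather than existentially quantified because uniform bounds for
  families of operators are compared later.\<close>

definition l2_bounded :: "('v \<Rightarrow> real) \<Rightarrow> real \<Rightarrow> (('v \<Rightarrow> real) \<Rightarrow> 'v \<Rightarrow> real) \<Rightarrow> bool" where
  "l2_bounded m C S \<longleftrightarrow>
     (\<forall>f\<in>l2 m. S f \<in> l2 m \<and> l2_norm m (S f) \<le> C * l2_norm m f) \<and>
     (\<forall>f\<in>l2 m. \<forall>g\<in>l2 m. \<forall>c d. S (\<lambda>x. c * f x + d * g x) = (\<lambda>x. c * S f x + d * S g x))"

lemma l2_bounded_le:
  assumes "l2_bounded m C S" "f \<in> l2 m"
  shows "S f \<in> l2 m" "l2_norm m (S f) \<le> C * l2_norm m f"
  using assms by (auto simp: l2_bounded_def)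

lemma l2_bounded_linear:
  assumes "l2_bounded m C S" "f \<in> l2 m" "g \<in> l2 m"
  shows "S (\<lambda>x. c * f x + d * g x) = (\<lambda>x. c * S f x + d * S g x)"
  using assms unfolding l2_bounded_def by blast

context weight
begin

lemma l2_bounded_simps:
  assumes S: "l2_bounded m C S" and f: "f \<in> l2 m"
  shows "S (\<lambda>x. 0) = (\<lambda>x. 0)"
    and "S (\<lambda>x. c * f x) = (\<lambda>x. c * S f x)"
    and "g \<in> l2 m \<Longrightarrow> S (\<lambda>x. f x + g x) = (\<lambda>x. S f x + S g x)"
    and "g \<in> l2 m \<Longrightarrow> S (\<lambda>x. f x - g x) = (\<lambda>x. S f x - S g x)"
  using l2_bounded_linear[OF S f f, of 0 0] l2_bounded_linear[OF S f f, of c 0]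
    l2_bounded_linear[OF S f, of g 1 1] l2_bounded_linear[OF S f, of g 1 "-1"] by auto

lemma l2_bounded_sum:
  assumes S: "l2_bounded m C S" and I: "finite I" and g: "\<And>i. i \<in> I \<Longrightarrow> g i \<in> l2 m"
  shows "S (\<lambda>x. \<Sum>i\<in>I. g i x) = (\<lambda>x. \<Sum>i\<in>I. S (g i) x)"
  using I g
proof (induction I rule: finite_induct)
  case empty
  then show ?case using l2_bounded_simps(1)[OF S l2_zero(1)] by simp
next
  case (insert i I)
  then show ?case
    using l2_bounded_simps(3)[OF S, of "g i" "\<lambda>x. \<Sum>i\<in>I. g i x"] l2_sum(1)[of I g] by simp
qed

lemma l2_bounded_power:
  assumes S: "l2_bounded m C S" and C: "0 \<le> C"
  shows "l2_bounded m (C ^ k) (S ^^ k)"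
proof (induction k)
  case 0
  then show ?case by (auto simp: l2_bounded_def)
next
  case (Suc k)
  have "l2_norm m (S ((S ^^ k) f)) \<le> C ^ Suc k * l2_norm m f" if f: "f \<in> l2 m" for f
  proof -
    have "l2_norm m (S ((S ^^ k) f)) \<le> C * l2_norm m ((S ^^ k) f)"
      using l2_bounded_le[OF S] l2_bounded_le[OF Suc f] by blast
    also have "\<dots> \<le> C * (C ^ k * l2_norm m f)"
      using C l2_bounded_le[OF Suc f] by (intro mult_left_mono) auto
    finally show ?thesis by (simp add: mult.assoc)
  qed
  then show ?case
    using Suc S unfolding l2_bounded_def by auto
qed

end

context positive_weight
begin

text \<open>Bounded operators may be applied term by term to absolutely convergent series, with the
  result read off at each vertex.\<close>

lemma l2_bounded_sums:
  assumes S: "l2_bounded m C S"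
    and g: "\<And>k. g k \<in> l2 m" and s: "summable (\<lambda>k. l2_norm m (g k))"
  shows "(\<lambda>k. S (g k) x) sums S (\<lambda>x. \<Sum>k. g k x) x"
proof -
  let ?G = "\<lambda>x. \<Sum>k. g k x"
  have G: "?G \<in> l2 m"
    using l2_absolutely_convergent_series(2)[of g, OF g s] .
  have p: "(\<lambda>x. \<Sum>k<n. g k x) \<in> l2 m" for n
    using g by (intro l2_sum) auto
  have "(\<lambda>n. l2_norm m (\<lambda>x. S (\<lambda>x. \<Sum>k<n. g k x) x - S ?G x)) \<longlonglongrightarrow> 0"
  proof (rule Lim_null_comparison)
    show "\<forall>\<^sub>F n in sequentially. norm (l2_norm m (\<lambda>x. S (\<lambda>x. \<Sum>k<n. g k x) x - S ?G x))
        \<le> C * l2_norm m (\<lambda>x. (\<Sum>k<n. g k x) - ?G x)"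
    proof (intro always_eventually allI)
      fix n
      have d: "(\<lambda>x. (\<Sum>k<n. g k x) - ?G x) \<in> l2 m"
        by (rule l2_diff(1)[OF p G])
      show "norm (l2_norm m (\<lambda>x. S (\<lambda>x. \<Sum>k<n. g k x) x - S ?G x))
        \<le> C * l2_norm m (\<lambda>x. (\<Sum>k<n. g k x) - ?G x)"
        using l2_bounded_le[OF S d] l2_norm_nonneg[of "S (\<lambda>x. (\<Sum>k<n. g k x) - ?G x)"]
        unfolding l2_bounded_simps(4)[OF S p G] by simp
    qed
    show "(\<lambda>n. C * l2_norm m (\<lambda>x. (\<Sum>k<n. g k x) - ?G x)) \<longlonglongrightarrow> 0"
      using l2_series_tendsto[of g, OF g s] by (rule tendsto_mult_right_zero)
  qed
  then have "(\<lambda>n. S (\<lambda>x. \<Sum>k<n. g k x) x) \<longlonglongrightarrow> S ?G x"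
    by (rule l2_norm_tendsto_pointwise[rotated 2]) (use l2_bounded_le[OF S] p G in auto)
  then show ?thesis
    unfolding sums_def using l2_bounded_sum[OF S, of "{..<_}" g] g by simp
qed

end

text \<open>The exponential series is summed at each vertex separately. The definition therefore makes
  sense without reference to a norm, and the same function is estimated below once in \<open>l2 m\<close> and
  once in the supremum norm.\<close>

definition operator_exp :: "(('v \<Rightarrow> real) \<Rightarrow> 'v \<Rightarrow> real) \<Rightarrow> real \<Rightarrow> ('v \<Rightarrow> real) \<Rightarrow> 'v \<Rightarrow> real" where
  "operator_exp L t f x = (\<Sum>k. t ^ k / fact k * (L ^^ k) f x)"

lemma operator_exp_zero: "operator_exp L 0 f = f"
proof
  fix x
  have "operator_exp L 0 f x = (\<Sum>k\<in>{0}. 0 ^ k / fact k * (L ^^ k) f x)"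
    unfolding operator_exp_def by (rule suminf_finite) auto
  then show "operator_exp L 0 f x = f x" by simp
qed

lemma summable_exp_real: "summable (\<lambda>k. z ^ k / fact k)" for z :: real
  using summable_exp[of z] by (simp add: field_simps)

locale bounded_operator = positive_weight m for m :: "'v \<Rightarrow> real" +
  fixes M :: real and L :: "('v \<Rightarrow> real) \<Rightarrow> 'v \<Rightarrow> real"
  assumes bounded: "l2_bounded m M L" and M_nonneg: "0 \<le> M"
begin

abbreviation exp_term :: "real \<Rightarrow> ('v \<Rightarrow> real) \<Rightarrow> nat \<Rightarrow> 'v \<Rightarrow> real" where
  "exp_term t f k \<equiv> (\<lambda>x. t ^ k / fact k * (L ^^ k) f x)"

lemma exp_term:
  assumes "f \<in> l2 m"
  shows "exp_term t f k \<in> l2 m"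
    and "l2_norm m (exp_term t f k) \<le> (\<bar>t\<bar> * M) ^ k / fact k * l2_norm m f"
proof -
  note p = l2_bounded_le[OF l2_bounded_power[OF bounded M_nonneg] assms, of k]
  show "exp_term t f k \<in> l2 m"
    by (rule l2_scale(1)[OF p(1)])
  have "l2_norm m (exp_term t f k) = \<bar>t\<bar> ^ k / fact k * l2_norm m ((L ^^ k) f)"
    using l2_scale(2)[OF p(1), of "t ^ k / fact k"] by (simp add: power_abs)
  also have "\<dots> \<le> \<bar>t\<bar> ^ k / fact k * (M ^ k * l2_norm m f)"
    by (intro mult_left_mono p) auto
  finally show "l2_norm m (exp_term t f k) \<le> (\<bar>t\<bar> * M) ^ k / fact k * l2_norm m f"
    by (simp add: power_mult_distrib algebra_simps)
qed

lemma summable_exp_term: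
  assumes "f \<in> l2 m"
  shows "summable (\<lambda>k. l2_norm m (exp_term t f k))"
proof (rule summable_comparison_test')
  show "summable (\<lambda>k. (\<bar>t\<bar> * M) ^ k / fact k * l2_norm m f)"
    by (intro summable_mult2 summable_exp_real)
qed (use exp_term[OF assms] l2_norm_nonneg in \<open>auto simp: abs_of_nonneg\<close>)

text \<open>The remainder is dominated by the remainder of the scalar series of \<open>exp (\<bar>t\<bar> * M)\<close>. For
  \<open>n = 0\<close> this is the norm bound, for \<open>n = 1\<close> strong continuity, and for \<open>n = 2\<close> the generator.\<close>

lemma operator_exp_remainder:
  assumes f: "f \<in> l2 m"
  shows "operator_exp L t f \<in> l2 m"
    and "l2_norm m (\<lambda>x. operator_exp L t f x - (\<Sum>k<n. exp_term t f k x))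
      \<le> (exp (\<bar>t\<bar> * M) - (\<Sum>k<n. (\<bar>t\<bar> * M) ^ k / fact k)) * l2_norm m f"
proof -
  let ?z = "\<bar>t\<bar> * M"
  have eq: "operator_exp L t f = (\<lambda>x. \<Sum>k. exp_term t f k x)"
    by (auto simp: operator_exp_def)
  note ser = l2_absolutely_convergent_series[of "exp_term t f", OF exp_term(1)[OF f] summable_exp_term[OF f]]
  show "operator_exp L t f \<in> l2 m"
    unfolding eq by (rule ser)
  have "l2_norm m (\<lambda>x. operator_exp L t f x - (\<Sum>k<n. exp_term t f k x))
      \<le> (\<Sum>k. l2_norm m (exp_term t f (k + n)))"
    unfolding eq by (rule ser)
  also have "\<dots> \<le> (\<Sum>k. ?z ^ (k + n) / fact (k + n) * l2_norm m f)"
    by (rule suminf_le[OF exp_term(2)[OF f]])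
      (intro summable_ignore_initial_segment summable_exp_term[OF f] summable_mult2
        summable_ignore_initial_segment[OF summable_exp_real])+
  also have "\<dots> = (\<Sum>k. ?z ^ (k + n) / fact (k + n)) * l2_norm m f"
    by (rule suminf_mult2[symmetric]) (rule summable_ignore_initial_segment[OF summable_exp_real])
  also have "(\<Sum>k. ?z ^ (k + n) / fact (k + n)) = exp ?z - (\<Sum>k<n. ?z ^ k / fact k)"
    using suminf_minus_initial_segment[OF summable_exp_real[of ?z], of n]
    by (simp add: exp_def field_simps)
  finally show "l2_norm m (\<lambda>x. operator_exp L t f x - (\<Sum>k<n. exp_term t f k x))
      \<le> (exp ?z - (\<Sum>k<n. ?z ^ k / fact k)) * l2_norm m f" .
qed

lemma operator_exp_sums:
  assumes "f \<in> l2 m"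
  shows "(\<lambda>k. exp_term t f k x) sums operator_exp L t f x"
  unfolding operator_exp_def
  using l2_absolutely_convergent_series(1)[of "exp_term t f", OF exp_term(1)[OF assms] summable_exp_term[OF assms]]
  by (rule summable_sums)

lemma operator_exp_bounded: "l2_bounded m (exp (\<bar>t\<bar> * M)) (operator_exp L t)"
  unfolding l2_bounded_def
proof (intro conjI ballI allI)
  fix f assume f: "f \<in> l2 m"
  show "operator_exp L t f \<in> l2 m"
    by (rule operator_exp_remainder[OF f])
  show "l2_norm m (operator_exp L t f) \<le> exp (\<bar>t\<bar> * M) * l2_norm m f"
    using operator_exp_remainder(2)[OF f, of t 0] by simp
next
  fix f g c d assume f: "f \<in> l2 m" and g: "g \<in> l2 m"
  have lin: "exp_term t (\<lambda>x. c * f x + d * g x) k x = c * exp_term t f k x + d * exp_term t g k x" for k x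
    by (simp add: l2_bounded_linear[OF l2_bounded_power[OF bounded M_nonneg] f g] algebra_simps add_divide_distrib)
  show "operator_exp L t (\<lambda>x. c * f x + d * g x) =
      (\<lambda>x. c * operator_exp L t f x + d * operator_exp L t g x)"
  proof
    fix x
    have "(\<lambda>k. exp_term t (\<lambda>x. c * f x + d * g x) k x) sums
        (c * operator_exp L t f x + d * operator_exp L t g x)"
      unfolding lin by (intro sums_add sums_mult operator_exp_sums f g)
    then show "operator_exp L t (\<lambda>x. c * f x + d * g x) x =
      c * operator_exp L t f x + d * operator_exp L t g x"
      unfolding operator_exp_def by (rule sums_unique[symmetric])
  qed
qed

lemma bounded_operator_operator_exp_sums:
  assumes S: "l2_bounded m C S" and f: "f \<in> l2 m"
  shows "(\<lambda>k. t ^ k / fact k * S ((L ^^ k) f) x) sums S (operator_exp L t f) x"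
proof -
  have "(\<lambda>k. S (exp_term t f k) x) sums S (\<lambda>x. \<Sum>k. exp_term t f k x) x"
    by (rule l2_bounded_sums[OF S]) (use exp_term(1)[OF f] summable_exp_term[OF f] in auto)
  moreover have "S (exp_term t f k) = (\<lambda>x. t ^ k / fact k * S ((L ^^ k) f) x)" for k
    by (rule l2_bounded_simps(2)[OF S l2_bounded_le(1)[OF l2_bounded_power[OF bounded M_nonneg] f]])
  moreover have "(\<lambda>x. \<Sum>k. exp_term t f k x) = operator_exp L t f"
    by (auto simp: operator_exp_def)
  ultimately show ?thesis by simp
qed

text \<open>An operator that commutes with \<open>L\<close> commutes with all its powers, and boundedness lets it pass
  through the series.\<close>

lemma operator_exp_commute:
  assumes S: "l2_bounded m C S" and comm: "\<And>f. f \<in> l2 m \<Longrightarrow> S (L f) = L (S f)" and f: "f \<in> l2 m"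
  shows "S (operator_exp L t f) = operator_exp L t (S f)"
proof
  fix x
  have pow: "S ((L ^^ k) f) = (L ^^ k) (S f)" for k
  proof (induction k)
    case (Suc k)
    then show ?case
      using comm[OF l2_bounded_le(1)[OF l2_bounded_power[OF bounded M_nonneg] f]] by simp
  qed simp
  show "S (operator_exp L t f) x = operator_exp L t (S f) x"
    using bounded_operator_operator_exp_sums[OF S f, of t x]
      operator_exp_sums[OF l2_bounded_le(1)[OF S f], of t x] sums_unique2
    unfolding pow by blast
qed

text \<open>Both sides sum the absolutely convergent double family
  \<open>s\<^sup>k t\<^sup>j (L ^^ (k + j)) f x / (k! j!)\<close>: by rows on the right, and along the diagonals \<open>k + j = n\<close>,
  where the binomial theorem applies, on the left.\<close>

lemma operator_exp_add:
  assumes f: "f \<in> l2 m"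
  shows "operator_exp L (s + t) f = operator_exp L s (operator_exp L t f)"
proof
  fix x
  define c where "c k = (L ^^ k) f x" for k
  define K where "K = l2_norm m f / sqrt (m x)"
  have c: "\<bar>c k\<bar> \<le> M ^ k * K" for k
  proof -
    note p = l2_bounded_le[OF l2_bounded_power[OF bounded M_nonneg] f, of k]
    have "\<bar>c k\<bar> \<le> l2_norm m ((L ^^ k) f) / sqrt (m x)"
      unfolding c_def by (rule abs_le_l2_norm[OF p(1)])
    also have "\<dots> \<le> M ^ k * l2_norm m f / sqrt (m x)"
      using p pos[of x] by (intro divide_right_mono) auto
    finally show ?thesis by (simp add: K_def)
  qed
  have K: "0 \<le> K"
    unfolding K_def using l2_norm_nonneg[OF f] pos[of x] by (auto intro!: divide_nonneg_nonneg)
  define a where "a = (\<lambda>(k, j). s ^ k / fact k * (t ^ j / fact j * c (k + j)))"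
  have exps: "(\<lambda>k. (r * M) ^ k / fact k) summable_on UNIV" if "0 \<le> r" for r :: real
    using that M_nonneg summable_exp_real by (subst summable_on_UNIV_nonneg_real_iff) auto
  have sum: "a summable_on UNIV"
  proof (rule abs_summable_summable, rule Infinite_Sum.abs_summable_on_comparison_test')
    have "(\<lambda>(k, j). (\<bar>s\<bar> * M) ^ k / fact k * ((\<bar>t\<bar> * M) ^ j / fact j)) summable_on UNIV \<times> UNIV"
    proof (rule summable_on_SigmaI)
      show "((\<lambda>j. case (k, j) of (k, j) \<Rightarrow> (\<bar>s\<bar> * M) ^ k / fact k * ((\<bar>t\<bar> * M) ^ j / fact j)) has_sum
          (\<bar>s\<bar> * M) ^ k / fact k * (\<Sum>\<^sub>\<infinity>j. (\<bar>t\<bar> * M) ^ j / fact j)) UNIV" for k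
        unfolding prod.case by (intro has_sum_cmult_right has_sum_infsum exps) simp
      show "(\<lambda>k. (\<bar>s\<bar> * M) ^ k / fact k * (\<Sum>\<^sub>\<infinity>j. (\<bar>t\<bar> * M) ^ j / fact j)) summable_on UNIV"
        by (intro summable_on_cmult_left exps) simp
    qed (use M_nonneg in auto)
    then have "(\<lambda>(k, j). (\<bar>s\<bar> * M) ^ k / fact k * ((\<bar>t\<bar> * M) ^ j / fact j) * K) summable_on UNIV"
      using summable_on_cmult_left[of "\<lambda>(k, j). (\<bar>s\<bar> * M) ^ k / fact k * ((\<bar>t\<bar> * M) ^ j / fact j)" UNIV K]
      by (simp add: case_prod_unfold)
    then show "(\<lambda>(k, j). (\<bar>s\<bar> * M) ^ k / fact k * ((\<bar>t\<bar> * M) ^ j / fact j) * K) summable_on UNIV" .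
    fix p :: "nat \<times> nat"
    obtain k j where p: "p = (k, j)" by fastforce
    have "norm (a p) = \<bar>s\<bar> ^ k / fact k * (\<bar>t\<bar> ^ j / fact j) * \<bar>c (k + j)\<bar>"
      by (simp add: a_def p abs_mult power_abs)
    also have "\<dots> \<le> \<bar>s\<bar> ^ k / fact k * (\<bar>t\<bar> ^ j / fact j) * (M ^ (k + j) * K)"
      using c by (intro mult_left_mono) auto
    also have "\<dots> = (\<bar>s\<bar> * M) ^ k / fact k * ((\<bar>t\<bar> * M) ^ j / fact j) * K"
      by (simp add: power_mult_distrib power_add)
    finally show "norm (a p) \<le> (case p of (k, j) \<Rightarrow> (\<bar>s\<bar> * M) ^ k / fact k * ((\<bar>t\<bar> * M) ^ j / fact j) * K)"
      by (simp add: p)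
  qed
  have eq1: "(\<Sum>\<^sub>\<infinity>p. a p) = operator_exp L s (operator_exp L t f) x"
  proof -
    have tf: "operator_exp L t f \<in> l2 m"
      by (rule operator_exp_remainder[OF f])
    have inner: "(\<lambda>j. a (k, j)) sums (s ^ k / fact k * (L ^^ k) (operator_exp L t f) x)" for k
    proof -
      have "(\<lambda>j. t ^ j / fact j * (L ^^ k) ((L ^^ j) f) x) sums (L ^^ k) (operator_exp L t f) x"
        by (rule bounded_operator_operator_exp_sums[OF l2_bounded_power[OF bounded M_nonneg] f])
      then have "(\<lambda>j. s ^ k / fact k * (t ^ j / fact j * (L ^^ k) ((L ^^ j) f) x)) sums
          (s ^ k / fact k * (L ^^ k) (operator_exp L t f) x)"
        by (rule sums_mult)
      then show ?thesis
        by (simp add: a_def c_def funpow_add)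
    qed
    have sumj: "(\<lambda>j. a (k, j)) summable_on UNIV" for k
      using summable_on_SigmaD1[of "\<lambda>k j. a (k, j)" UNIV "\<lambda>_. UNIV" k] sum by simp
    have infj: "(\<Sum>\<^sub>\<infinity>j. a (k, j)) = s ^ k / fact k * (L ^^ k) (operator_exp L t f) x" for k
      using has_sum_imp_sums[OF has_sum_infsum[OF sumj]] inner sums_unique2 by blast
    have "(\<Sum>\<^sub>\<infinity>p. a p) = (\<Sum>\<^sub>\<infinity>k. \<Sum>\<^sub>\<infinity>j. a (k, j))"
      using infsum_Sigma'_banach[of "\<lambda>k j. a (k, j)" UNIV "\<lambda>_. UNIV"] sum by simp
    also have "\<dots> = (\<Sum>\<^sub>\<infinity>k. exp_term s (operator_exp L t f) k x)"
      unfolding infj ..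
    finally have e: "(\<Sum>\<^sub>\<infinity>p. a p) = (\<Sum>\<^sub>\<infinity>k. exp_term s (operator_exp L t f) k x)" .
    have "(\<lambda>k. \<Sum>\<^sub>\<infinity>j. a (k, j)) summable_on UNIV"
      using summable_on_Sigma_banach[of "\<lambda>k j. a (k, j)" UNIV "\<lambda>_. UNIV"] sum by simp
    then have "(\<lambda>k. exp_term s (operator_exp L t f) k x) summable_on UNIV"
      unfolding infj .
    from has_sum_imp_sums[OF has_sum_infsum[OF this]] operator_exp_sums[OF tf]
    show ?thesis unfolding e using sums_unique2 by blast
  qed
  \<comment> \<open>Sum the same family along the diagonals, indexed by \<open>n = k + j\<close> and \<open>k\<close>.\<close>
  have bij: "bij_betw (\<lambda>(n, k). (k, n - k)) (SIGMA n:UNIV. {..n}) (UNIV :: (nat \<times> nat) set)"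
    by (rule bij_betw_byWitness[where f' = "\<lambda>(k, j). (k + j, k)"]) auto
  have binom: "(\<Sum>k\<le>n. a (k, n - k)) = exp_term (s + t) f n x" for n
  proof -
    have "(\<Sum>k\<le>n. a (k, n - k)) = (\<Sum>k\<le>n. of_nat (n choose k) * s ^ k * t ^ (n - k)) / fact n * c n"
      unfolding sum_divide_distrib sum_distrib_right
      by (intro sum.cong) (auto simp: a_def binomial_fact)
    then show ?thesis
      by (simp add: binomial_ring c_def)
  qed
  have sum': "(\<lambda>(n, k). a (k, n - k)) summable_on (SIGMA n:UNIV. {..n})"
    using summable_on_reindex_bij_betw[OF bij, of a] sum by (simp add: case_prod_unfold)
  have "(\<Sum>\<^sub>\<infinity>p. a p) = (\<Sum>\<^sub>\<infinity>(n, k)\<in>(SIGMA n:UNIV. {..n}). a (k, n - k))"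
    using infsum_reindex_bij_betw[OF bij, of a] by (simp add: case_prod_unfold)
  also have "\<dots> = (\<Sum>\<^sub>\<infinity>n. \<Sum>\<^sub>\<infinity>k\<in>{..n}. a (k, n - k))"
    using infsum_Sigma'_banach[OF sum'] by simp
  also have "\<dots> = (\<Sum>\<^sub>\<infinity>n. exp_term (s + t) f n x)"
    by (simp add: binom)
  finally have e: "(\<Sum>\<^sub>\<infinity>p. a p) = (\<Sum>\<^sub>\<infinity>n. exp_term (s + t) f n x)" .
  have "(\<lambda>n. \<Sum>\<^sub>\<infinity>k\<in>{..n}. a (k, n - k)) summable_on UNIV"
    using summable_on_Sigma_banach[OF sum'] by simp
  then have "(\<lambda>n. exp_term (s + t) f n x) summable_on UNIV"
    by (simp add: binom)
  from has_sum_imp_sums[OF has_sum_infsum[OF this]] operator_exp_sums[OF f]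
  show "operator_exp L (s + t) f x = operator_exp L s (operator_exp L t f) x"
    unfolding eq1[symmetric] e using sums_unique2 by blast
qed

text \<open>Since the remainder of order two is \<open>o(t)\<close> for every \<open>f\<close>, the generator is defined on all of
  \<open>l2 m\<close>.\<close>

lemma operator_exp_semigroup:
  "C0_semigroup m (\<lambda>t. operator_exp L (- t))"
  "generator m (\<lambda>t. operator_exp L (- t)) = {(f, \<lambda>x. - L f x) | f. f \<in> l2 m}"
proof -
  have cont: "((\<lambda>t. l2_norm m (\<lambda>x. operator_exp L (- t) f x - f x)) \<longlongrightarrow> 0) (at_right 0)"
    if f: "f \<in> l2 m" for f
  proof (rule Lim_null_comparison)
    have "norm (l2_norm m (\<lambda>x. operator_exp L (- t) f x - f x)) \<le> (exp (\<bar>t\<bar> * M) - 1) * l2_norm m f" for t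
      using operator_exp_remainder(2)[OF f, of "- t" 1]
        l2_norm_nonneg[OF l2_diff(1)[OF operator_exp_remainder(1)[OF f] f], of "- t"] by simp
    then show "\<forall>\<^sub>F t in at_right 0. norm (l2_norm m (\<lambda>x. operator_exp L (- t) f x - f x))
        \<le> (exp (\<bar>t\<bar> * M) - 1) * l2_norm m f"
      by (intro always_eventually allI)
    have "((\<lambda>t. (exp (\<bar>t\<bar> * M) - 1) * l2_norm m f) \<longlongrightarrow> (exp (\<bar>0\<bar> * M) - 1) * l2_norm m f) (at_right 0)"
      by (intro tendsto_intros)
    then show "((\<lambda>t. (exp (\<bar>t\<bar> * M) - 1) * l2_norm m f) \<longlongrightarrow> 0) (at_right 0)"
      by simp
  qed
  show "C0_semigroup m (\<lambda>t. operator_exp L (- t))"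
    unfolding C0_semigroup_def
  proof (intro conjI allI impI ballI)
    fix t :: real and f
    assume "0 \<le> t" "f \<in> l2 m"
    show "operator_exp L (- t) f \<in> l2 m"
      using operator_exp_remainder(1) \<open>f \<in> l2 m\<close> by blast
  next
    fix t :: real and f g c d
    assume "0 \<le> t" "f \<in> l2 m" "g \<in> l2 m"
    then show "operator_exp L (- t) (\<lambda>x. c * f x + d * g x) =
       (\<lambda>x. c * operator_exp L (- t) f x + d * operator_exp L (- t) g x)"
      using l2_bounded_linear[OF operator_exp_bounded] by blast
  next
    fix t :: real
    show "\<exists>C. \<forall>f\<in>l2 m. l2_norm m (operator_exp L (- t) f) \<le> C * l2_norm m f"
      using l2_bounded_le(2)[OF operator_exp_bounded] by blast
  next
    fix f
    show "operator_exp L (- 0) f = f" by (simp add: operator_exp_zero)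
  next
    fix s t :: real and f assume "f \<in> l2 m"
    then show "operator_exp L (- (s + t)) f = operator_exp L (- s) (operator_exp L (- t) f)"
      using operator_exp_add[of f "- s" "- t"] by simp
  qed (use cont in auto)
  have der: "((\<lambda>t. l2_norm m (\<lambda>x. (operator_exp L (- t) f x - f x) / t - (- L f x))) \<longlongrightarrow> 0) (at_right 0)"
    if f: "f \<in> l2 m" for f
  proof (rule Lim_null_comparison)
    show "\<forall>\<^sub>F t in at_right 0. norm (l2_norm m (\<lambda>x. (operator_exp L (- t) f x - f x) / t - (- L f x)))
        \<le> (exp (t * M) - 1 - t * M) / t * l2_norm m f"
      using eventually_at_right_less[of 0]
    proof eventually_elim
      fix t :: real assume t: "0 < t"
      let ?r = "\<lambda>x. operator_exp L (- t) f x - (\<Sum>k<2. exp_term (- t) f k x)"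
      have eq: "(\<lambda>x. (operator_exp L (- t) f x - f x) / t - (- L f x)) = (\<lambda>x. 1 / t * ?r x)"
        using t by (auto simp: numeral_2_eq_2 field_simps)
      have r: "?r \<in> l2 m"
        by (intro l2_diff l2_sum operator_exp_remainder exp_term f) auto
      have "norm (l2_norm m (\<lambda>x. 1 / t * ?r x)) = 1 / t * l2_norm m ?r"
        using l2_scale(2)[OF r, of "1 / t"] l2_norm_nonneg[OF r] t by simp
      also have "\<dots> \<le> 1 / t * ((exp (t * M) - 1 - t * M) * l2_norm m f)"
        using operator_exp_remainder(2)[OF f, of "- t" 2] t
        by (intro mult_left_mono) (auto simp: numeral_2_eq_2 diff_diff_eq)
      finally show "norm (l2_norm m (\<lambda>x. (operator_exp L (- t) f x - f x) / t - (- L f x)))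
        \<le> (exp (t * M) - 1 - t * M) / t * l2_norm m f"
        unfolding eq by simp
    qed
    have "((\<lambda>t. exp (t * M)) has_real_derivative M) (at 0)"
      by (auto intro!: derivative_eq_intros)
    then have "((\<lambda>t. (exp (t * M) - 1) / t - M) \<longlongrightarrow> M - M) (at_right 0)"
      by (intro tendsto_diff tendsto_const)
        (auto simp: has_field_derivative_iff intro: tendsto_within_subset)
    then have "((\<lambda>t. (exp (t * M) - 1) / t - M) \<longlongrightarrow> 0) (at_right 0)"
      by simp
    then have "((\<lambda>t. (exp (t * M) - 1 - t * M) / t) \<longlongrightarrow> 0) (at_right 0)"
      by (rule Lim_transform_eventually)
        (use eventually_at_right_less[of 0] in eventually_elim, auto simp: field_simps)
    then show "((\<lambda>t. (exp (t * M) - 1 - t * M) / t * l2_norm m f) \<longlongrightarrow> 0) (at_right 0)"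
      by (rule tendsto_mult_left_zero)
  qed
  show "generator m (\<lambda>t. operator_exp L (- t)) = {(f, \<lambda>x. - L f x) | f. f \<in> l2 m}"
  proof (intro equalityI subsetI)
    fix p assume "p \<in> {(f, \<lambda>x. - L f x) | f. f \<in> l2 m}"
    then obtain f where f: "f \<in> l2 m" and p: "p = (f, \<lambda>x. - L f x)" by blast
    have "(\<lambda>x. - L f x) \<in> l2 m"
      using l2_scale(1)[OF l2_bounded_le(1)[OF bounded f], of "-1"] by simp
    then show "p \<in> generator m (\<lambda>t. operator_exp L (- t))"
      using der[OF f] f by (simp add: p generator_def)
  next
    fix p assume "p \<in> generator m (\<lambda>t. operator_exp L (- t))"
    then obtain f h where p: "p = (f, h)" and f: "f \<in> l2 m" and h: "h \<in> l2 m"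
      and lim: "((\<lambda>t. l2_norm m (\<lambda>x. (operator_exp L (- t) f x - f x) / t - h x)) \<longlongrightarrow> 0) (at_right 0)"
      unfolding generator_def by blast
    have "h = (\<lambda>x. - L f x)"
    proof (rule l2_norm_tendsto_unique[OF _ h _ _ lim der[OF f]])
      show "(\<lambda>x. (operator_exp L (- t) f x - f x) / t) \<in> l2 m" for t
        using l2_scale(1)[OF l2_diff(1)[OF operator_exp_remainder(1)[OF f] f], of "1 / t"] by simp
      show "(\<lambda>x. - L f x) \<in> l2 m"
        using l2_scale(1)[OF l2_bounded_le(1)[OF bounded f], of "-1"] by simp
    qed simp
    then show "p \<in> {(f, \<lambda>x. - L f x) | f. f \<in> l2 m}"
      using f p by blast
  qed
qed

end

section \<open>Uniform boundedness\<close>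

context positive_weight
begin

text \<open>If \<open>N\<close> is not a bound, then the infimum of the bounds above \<open>N\<close> plays the role of the operator
  norm: a bound \<open>C\<close> slightly larger than it is almost attained at some \<open>f\<close>.\<close>

lemma l2_bounded_almost_attained:
  assumes S: "l2_bounded m D\<^sub>0 S" and N: "0 < N" and not: "\<not> l2_bounded m N S"
  obtains C f where "l2_bounded m C S" "N < C" "f \<in> l2 m" "0 < l2_norm m f"
    "2 / 3 * C * l2_norm m f < l2_norm m (S f)"
proof -
  let ?B = "{C. N \<le> C \<and> l2_bounded m C S}"
  have mono: "l2_bounded m D S" if "l2_bounded m C S" "C \<le> D" for C D
  proof -
    have "C * l2_norm m f \<le> D * l2_norm m f" if "f \<in> l2 m" for f
      using \<open>C \<le> D\<close> l2_norm_nonneg[OF that] by (rule mult_right_mono)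
    with that show ?thesis
      unfolding l2_bounded_def by (meson order_trans)
  qed
  have witness: "\<exists>f\<in>l2 m. D * l2_norm m f < l2_norm m (S f)" if "\<not> l2_bounded m D S" for D
    using S that unfolding l2_bounded_def by (meson not_le)
  have "N \<le> D\<^sub>0"
    using mono[OF S, of N] not by linarith
  then have ne: "?B \<noteq> {}" using S by blast
  have bdd: "bdd_below ?B" by (rule bdd_belowI[of _ N]) auto
  have N': "N \<le> Inf ?B" by (rule cInf_greatest[OF ne]) auto
  \<comment> \<open>The factor \<open>6/5\<close> serves because \<open>2/3 * 6/5 < 1\<close>.\<close>
  have "Inf ?B < 6 / 5 * Inf ?B" using N N' by simp
  then obtain C where C: "N \<le> C" "l2_bounded m C S" "C < 6 / 5 * Inf ?B"
    using cInf_lessD[OF ne] by blast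
  have "\<not> l2_bounded m (2 / 3 * C) S"
  proof
    assume a: "l2_bounded m (2 / 3 * C) S"
    then have "N \<le> 2 / 3 * C"
      using mono[OF a, of N] not by linarith
    with a have "Inf ?B \<le> 2 / 3 * C"
      by (intro cInf_lower bdd) auto
    with C(3) N N' show False by simp
  qed
  then obtain f where f: "f \<in> l2 m" "2 / 3 * C * l2_norm m f < l2_norm m (S f)"
    using witness by blast
  moreover have "l2_norm m f \<noteq> 0"
    using f l2_bounded_le(2)[OF S f(1)] N C(1) l2_norm_nonneg[OF f(1)] by auto
  moreover have "N \<noteq> C"
    using C(2) not by blast
  ultimately show ?thesis
    using that[of C f] C(1,2) l2_norm_nonneg[OF f(1)] by auto
qed

text \<open>A gliding hump argument. Among \<open>y + \<xi>\<close> and \<open>y - \<xi>\<close> at least one has an image under \<open>R\<close> of norm at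
  least \<open>l2_norm m (R \<xi>)\<close>, because the two images differ by \<open>2 R \<xi>\<close>. If the operators had no
  common bound, one could add steps \<open>\<plusminus>\<xi> n\<close> of norm \<open>3^(-n)\<close>, each almost attaining the bound
  \<open>C n > 4 ^ n\<close> of an operator \<open>R n\<close>. The later steps have total norm \<open>3^(-n) / 2\<close>, too small to cancel
  the gain \<open>2/3 C n 3^(-n)\<close>, so the orbit of the limit would be unbounded.\<close>

theorem l2_uniform_boundedness:
  assumes S: "\<And>i. i \<in> I \<Longrightarrow> \<exists>C. l2_bounded m C (S i)"
    and orbits: "\<And>f. f \<in> l2 m \<Longrightarrow> \<exists>K. \<forall>i\<in>I. l2_norm m (S i f) \<le> K"
  shows "\<exists>C. \<forall>i\<in>I. l2_bounded m C (S i)"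
proof (rule ccontr)
  assume "\<not> ?thesis"
  then have "\<forall>n. \<exists>i\<in>I. \<not> l2_bounded m (4 ^ n) (S i)" for n :: nat by blast
  then obtain i where i: "\<And>n. i n \<in> I" "\<And>n :: nat. \<not> l2_bounded m (4 ^ n) (S (i n))"
    by metis
  define R where "R n = S (i n)" for n
  have "\<exists>C f. l2_bounded m C (R n) \<and> 4 ^ n < C \<and> f \<in> l2 m \<and> 0 < l2_norm m f \<and>
      2 / 3 * C * l2_norm m f < l2_norm m (R n f)" for n
  proof -
    obtain D\<^sub>0 where "l2_bounded m D\<^sub>0 (S (i n))" using S i(1) by blast
    from l2_bounded_almost_attained[OF this _ i(2)] show ?thesis
      unfolding R_def by (metis zero_less_numeral zero_less_power)
  qed
  then obtain C f where C: "\<And>n. l2_bounded m (C n) (R n)" "\<And>n. 4 ^ n < C n"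
    and f: "\<And>n. f n \<in> l2 m" "\<And>n. 0 < l2_norm m (f n)"
      "\<And>n. 2 / 3 * C n * l2_norm m (f n) < l2_norm m (R n (f n))"
    by metis
  define \<xi> where "\<xi> n = (\<lambda>x. (1/3) ^ n / l2_norm m (f n) * f n x)" for n
  have \<xi>: "\<xi> n \<in> l2 m" "l2_norm m (\<xi> n) = (1/3) ^ n" "2 / 3 * C n * (1/3) ^ n < l2_norm m (R n (\<xi> n))" for n
  proof -
    show "\<xi> n \<in> l2 m" unfolding \<xi>_def by (rule l2_scale(1)[OF f(1)])
    show "l2_norm m (\<xi> n) = (1/3) ^ n"
      unfolding \<xi>_def l2_scale(2)[OF f(1)] using f(2)[of n] by simp
    have "R n (\<xi> n) = (\<lambda>x. (1/3) ^ n / l2_norm m (f n) * R n (f n) x)"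
      unfolding \<xi>_def by (rule l2_bounded_simps(2)[OF C(1) f(1)])
    then have "l2_norm m (R n (\<xi> n)) = \<bar>(1/3) ^ n / l2_norm m (f n)\<bar> * l2_norm m (R n (f n))"
      using l2_scale(2)[OF l2_bounded_le(1)[OF C(1) f(1)]] by (simp only:)
    then have "l2_norm m (R n (\<xi> n)) = (1/3) ^ n / l2_norm m (f n) * l2_norm m (R n (f n))"
      using f(2)[of n] by simp
    moreover have "(1/3) ^ n / l2_norm m (f n) * (2 / 3 * C n * l2_norm m (f n))
        < (1/3) ^ n / l2_norm m (f n) * l2_norm m (R n (f n))"
      using f(2,3)[of n] by (intro mult_strict_left_mono) auto
    moreover have "(1/3) ^ n / l2_norm m (f n) * (2 / 3 * C n * l2_norm m (f n)) = 2 / 3 * C n * (1/3) ^ n"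
      using f(2)[of n] by simp
    ultimately show "2 / 3 * C n * (1/3) ^ n < l2_norm m (R n (\<xi> n))"
      by simp
  qed
  have step: "\<exists>\<sigma>. \<bar>\<sigma>\<bar> = 1 \<and> l2_norm m (R n (\<xi> n)) \<le> l2_norm m (R n (\<lambda>x. y x + \<sigma> * \<xi> n x))"
    if y: "y \<in> l2 m" for n y
  proof -
    have e: "R n (\<lambda>x. y x + \<sigma> * \<xi> n x) = (\<lambda>x. R n y x + \<sigma> * R n (\<xi> n) x)" for \<sigma>
      using l2_bounded_linear[OF C(1)[of n] y \<xi>(1)[of n], of 1] by simp
    note l = l2_bounded_le(1)[OF C(1)[of n]]
    have l2: "(\<lambda>x. R n y x + \<sigma> * R n (\<xi> n) x) \<in> l2 m" for \<sigma>
      by (intro l2_add l2_scale l y \<xi>)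
    have "(\<lambda>x. (R n y x + 1 * R n (\<xi> n) x) - (R n y x + (-1) * R n (\<xi> n) x)) = (\<lambda>x. 2 * R n (\<xi> n) x)"
      by auto
    then have "2 * l2_norm m (R n (\<xi> n)) \<le> l2_norm m (\<lambda>x. R n y x + 1 * R n (\<xi> n) x)
        + l2_norm m (\<lambda>x. R n y x + (-1) * R n (\<xi> n) x)"
      using l2_diff(2)[OF l2[of 1] l2[of "-1"]] l2_scale(2)[OF l[OF \<xi>(1)[of n]], of 2] by simp
    then have "l2_norm m (R n (\<xi> n)) \<le> l2_norm m (R n (\<lambda>x. y x + 1 * \<xi> n x)) \<or>
        l2_norm m (R n (\<xi> n)) \<le> l2_norm m (R n (\<lambda>x. y x + (-1) * \<xi> n x))"
      unfolding e by linarith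
    then show ?thesis
      by (metis abs_minus abs_one)
  qed
  define \<sigma> :: "nat \<Rightarrow> ('v \<Rightarrow> real) \<Rightarrow> real" where
    "\<sigma> n y = (SOME \<sigma>. \<bar>\<sigma>\<bar> = 1 \<and> l2_norm m (R n (\<xi> n)) \<le> l2_norm m (R n (\<lambda>x. y x + \<sigma> * \<xi> n x)))" for n y
  have \<sigma>: "\<bar>\<sigma> n y\<bar> = 1" "l2_norm m (R n (\<xi> n)) \<le> l2_norm m (R n (\<lambda>x. y x + \<sigma> n y * \<xi> n x))"
    if "y \<in> l2 m" for n y
    using someI_ex[OF step[OF that, of n]] unfolding \<sigma>_def by blast+
  define y where "y = rec_nat (\<lambda>x. 0) (\<lambda>n u x. u x + \<sigma> n u * \<xi> n x)"
  have y_simps: "y 0 = (\<lambda>x. 0)" "y (Suc n) = (\<lambda>x. y n x + \<sigma> n (y n) * \<xi> n x)" for n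
    by (simp_all add: y_def)
  have y: "y n \<in> l2 m" for n
    by (induction n) (auto simp: y_simps l2_zero intro!: l2_add l2_scale \<xi>)
  define g where "g n = (\<lambda>x. \<sigma> n (y n) * \<xi> n x)" for n
  have y_sum: "y n x = (\<Sum>k<n. g k x)" for n x
    by (induction n) (auto simp: y_simps g_def)
  have g: "g n \<in> l2 m" "l2_norm m (g n) = (1/3) ^ n" for n
    unfolding g_def using l2_scale[OF \<xi>(1)] \<xi>(2) \<sigma>(1)[OF y] by auto
  have s: "summable (\<lambda>n. l2_norm m (g n))"
    unfolding g by (simp add: summable_geometric)
  define u where "u = (\<lambda>x. \<Sum>k. g k x)"
  have u: "u \<in> l2 m"
    unfolding u_def by (rule l2_absolutely_convergent_series(2)) (use g s in auto)
  have tail: "l2_norm m (\<lambda>x. u x - y (Suc n) x) \<le> (1/3) ^ n / 2" for n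
  proof -
    have "l2_norm m (\<lambda>x. u x - y (Suc n) x) \<le> (\<Sum>k. l2_norm m (g (k + Suc n)))"
      unfolding u_def y_sum by (rule l2_absolutely_convergent_series(3)) (use g s in auto)
    also have "\<dots> = (\<Sum>k. (1/3) ^ k * (1/3) ^ Suc n)"
      by (simp add: g power_add)
    also have "\<dots> = (\<Sum>k. (1/3) ^ k) * (1/3) ^ Suc n"
      by (rule suminf_mult2[symmetric]) (simp add: summable_geometric)
    also have "\<dots> = (1/3) ^ n / 2"
      by (simp add: suminf_geometric)
    finally show ?thesis .
  qed
  \<comment> \<open>The gain \<open>2/3\<close> minus the loss \<open>1/2\<close> leaves \<open>1/6\<close>.\<close>
  have large: "(4/3) ^ n / 6 \<le> l2_norm m (R n u)" for n
  proof -
    have d: "(\<lambda>x. u x - y (Suc n) x) \<in> l2 m"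
      by (rule l2_diff(1)[OF u y])
    have "l2_norm m (R n (\<lambda>x. u x - y (Suc n) x)) \<le> C n * ((1/3) ^ n / 2)"
    proof -
      have "0 \<le> C n" using C(2)[of n] zero_le_power[of "4::real" n] by linarith
      then show ?thesis
        using l2_bounded_le(2)[OF C(1)[of n] d] mult_left_mono[OF tail[of n], of "C n"] by linarith
    qed
    moreover have "R n (\<lambda>x. u x - y (Suc n) x) = (\<lambda>x. R n u x - R n (y (Suc n)) x)"
      by (rule l2_bounded_simps(4)[OF C(1) u y])
    moreover have "2 / 3 * C n * (1/3) ^ n \<le> l2_norm m (R n (y (Suc n)))"
      using \<xi>(3)[of n] \<sigma>(2)[OF y[of n], of n] by (simp add: y_simps)
    moreover have "l2_norm m (R n (y (Suc n))) - l2_norm m (R n u) \<le> l2_norm m (\<lambda>x. R n u x - R n (y (Suc n)) x)"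
      using l2_norm_diff_ge[OF l2_bounded_le(1)[OF C(1) y] l2_bounded_le(1)[OF C(1) u]]
      by (subst l2_norm_minus_commute)
    ultimately have "C n * (1/3) ^ n / 6 \<le> l2_norm m (R n u)"
      by simp
    moreover have "4 ^ n * (1/3) ^ n \<le> C n * (1/3) ^ n"
      using C(2)[of n] by (intro mult_right_mono) auto
    moreover have "4 ^ n * (1/3) ^ n = (4/3 :: real) ^ n"
      by (simp add: power_mult_distrib[symmetric])
    ultimately show ?thesis by linarith
  qed
  obtain K where K: "\<And>n. l2_norm m (R n u) \<le> K"
    using orbits[OF u] i(1) unfolding R_def by blast
  obtain n where "6 * K < (4/3) ^ n"
    using real_arch_pow[of "4/3" "6 * K"] by auto
  with large[of n] K[of n] show False by linarith
qed

end

section \<open>Semigroups with a bounded generator\<close>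

context positive_weight
begin

lemma C0_semigroup_D:
  assumes T: "C0_semigroup m T"
  shows "0 \<le> t \<Longrightarrow> \<exists>C. l2_bounded m C (T t)"
    and "f \<in> l2 m \<Longrightarrow> T 0 f = f"
    and "0 \<le> s \<Longrightarrow> 0 \<le> t \<Longrightarrow> f \<in> l2 m \<Longrightarrow> T (s + t) f = T s (T t f)"
    and "f \<in> l2 m \<Longrightarrow> ((\<lambda>t. l2_norm m (\<lambda>x. T t f x - f x)) \<longlongrightarrow> 0) (at_right 0)"
    and "0 \<le> t \<Longrightarrow> f \<in> l2 m \<Longrightarrow> T t f \<in> l2 m"
proof -
  have l2: "\<And>t f. 0 \<le> t \<Longrightarrow> f \<in> l2 m \<Longrightarrow> T t f \<in> l2 m"
    and lin: "\<And>t f g c d. 0 \<le> t \<Longrightarrow> f \<in> l2 m \<Longrightarrow> g \<in> l2 m \<Longrightarrow>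
        T t (\<lambda>x. c * f x + d * g x) = (\<lambda>x. c * T t f x + d * T t g x)"
    and bound: "\<And>t. 0 \<le> t \<Longrightarrow> \<exists>C. \<forall>f\<in>l2 m. l2_norm m (T t f) \<le> C * l2_norm m f"
    using T by (simp_all add: C0_semigroup_def)
  show "\<exists>C. l2_bounded m C (T t)" if t: "0 \<le> t"
  proof -
    obtain C where "\<forall>f\<in>l2 m. l2_norm m (T t f) \<le> C * l2_norm m f"
      using bound[OF t] by blast
    then have "l2_bounded m C (T t)"
      unfolding l2_bounded_def using l2[OF t] lin[OF t] by simp
    then show ?thesis ..
  qed
qed (use T in \<open>simp_all add: C0_semigroup_def\<close>)

text \<open>The definition of a semigroup bounds each operator \<open>T t\<close> separately. Unbounded norms near \<open>0\<close>
  would occur along a sequence of times tending to \<open>0\<close>, along which every orbit converges; this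
  contradicts uniform boundedness.\<close>

lemma C0_semigroup_bounded_near_0:
  assumes T: "C0_semigroup m T"
  obtains \<delta> B where "0 < \<delta>" "1 \<le> B" "\<And>s. 0 \<le> s \<Longrightarrow> s \<le> \<delta> \<Longrightarrow> l2_bounded m B (T s)"
proof -
  have "\<exists>\<delta> B. 0 < \<delta> \<and> 0 \<le> B \<and> (\<forall>s. 0 < s \<and> s \<le> \<delta> \<longrightarrow> l2_bounded m B (T s))"
  proof (rule ccontr)
    assume "\<not> ?thesis"
    then have neg: "0 < \<delta> \<Longrightarrow> 0 \<le> B \<Longrightarrow> \<exists>s. 0 < s \<and> s \<le> \<delta> \<and> \<not> l2_bounded m B (T s)" for \<delta> B
      by blast
    have "\<exists>s. 0 < s \<and> s \<le> inverse (real (Suc n)) \<and> \<not> l2_bounded m (real n) (T s)" for n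
      by (rule neg) auto
    then obtain s where s: "\<And>n. 0 < s n" "\<And>n. s n \<le> inverse (real (Suc n))"
      "\<And>n. \<not> l2_bounded m (real n) (T (s n))"
      by metis
    have "s \<longlonglongrightarrow> 0"
      by (rule tendsto_sandwich[OF _ _ tendsto_const LIMSEQ_inverse_real_of_nat])
        (use s in \<open>auto intro!: always_eventually less_imp_le\<close>)
    then have lim: "filterlim s (at_right 0) sequentially"
      by (intro tendsto_imp_filterlim_at_right) (use s in auto)
    have "\<exists>K. \<forall>n\<in>UNIV. l2_norm m (T (s n) f) \<le> K" if f: "f \<in> l2 m" for f
    proof -
      have "(\<lambda>n. l2_norm m (\<lambda>x. T (s n) f x - f x)) \<longlonglongrightarrow> 0"
        using filterlim_compose[OF C0_semigroup_D(4)[OF T f] lim] .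
      then have "Bseq (\<lambda>n. l2_norm m (\<lambda>x. T (s n) f x - f x))"
        by (rule convergentI[THEN convergent_imp_Bseq])
      then obtain K where K: "\<And>n. \<bar>l2_norm m (\<lambda>x. T (s n) f x - f x)\<bar> \<le> K"
        unfolding Bseq_def by auto
      have "l2_norm m (T (s n) f) \<le> K + l2_norm m f" for n
        using K[of n] l2_norm_diff_ge[OF C0_semigroup_D(5)[OF T less_imp_le[OF s(1)] f] f, of n] by linarith
      then show ?thesis by blast
    qed
    with l2_uniform_boundedness[of UNIV "\<lambda>n. T (s n)"] C0_semigroup_D(1)[OF T less_imp_le[OF s(1)]]
    obtain C where C: "\<And>n. l2_bounded m C (T (s n))" by blast
    obtain n where n: "C \<le> real n" using real_arch_simple by blast
    have "l2_bounded m (real n) (T (s n))"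
      using C[of n] n unfolding l2_bounded_def
      by (meson l2_norm_nonneg mult_right_mono order_trans)
    with s(3) show False by blast
  qed
  then obtain \<delta> B where \<delta>: "0 < \<delta>" "0 \<le> B" "\<And>s. 0 < s \<Longrightarrow> s \<le> \<delta> \<Longrightarrow> l2_bounded m B (T s)"
    by blast
  have "l2_bounded m (max 1 B) (T s)" if "0 \<le> s" "s \<le> \<delta>" for s
  proof -
    have *: "\<exists>C\<le>max 1 B. l2_bounded m C (T s)"
    proof (cases "s = 0")
      case True
      have "l2_bounded m 1 (T 0)"
      proof -
        have "(\<lambda>x. c * f x + d * g x) \<in> l2 m" if "f \<in> l2 m" "g \<in> l2 m" for c d f g
          using that by (intro l2_add l2_scale)
        then show ?thesis
          unfolding l2_bounded_def using C0_semigroup_D(2)[OF T] by simp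
      qed
      then show ?thesis using True by (intro exI[of _ 1]) auto
    next
      case False
      then show ?thesis using \<delta>(3)[of s] that by (intro exI[of _ B]) auto
    qed
    then show ?thesis
      unfolding l2_bounded_def by (meson l2_norm_nonneg mult_right_mono order_trans)
  qed
  then show ?thesis using that[of \<delta> "max 1 B"] \<delta> by auto
qed

end

context bounded_operator
begin

text \<open>Applying the bounded operator \<open>T t\<close> to the difference quotients of \<open>f\<close> yields those of \<open>T t f\<close>.
  The former converge to \<open>- T t (L f)\<close> and the latter to \<open>- L (T t f)\<close>.\<close>

lemma C0_semigroup_commute_generator:
  assumes T: "C0_semigroup m T" and gen: "generator m T = {(f, \<lambda>x. - L f x) | f. f \<in> l2 m}"
    and t: "0 \<le> t" and f: "f \<in> l2 m"
  shows "T t (L f) = L (T t f)"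
proof -
  obtain C where C: "l2_bounded m C (T t)" using C0_semigroup_D(1)[OF T t] by blast
  have Tf: "T t f \<in> l2 m" by (rule l2_bounded_le(1)[OF C f])
  have neg: "(\<lambda>x. - L g x) \<in> l2 m" if "g \<in> l2 m" for g
    using l2_scale(1)[OF l2_bounded_le(1)[OF bounded that], of "-1"] by simp
  have lim: "((\<lambda>h. l2_norm m (\<lambda>x. (T h g x - g x) / h - - L g x)) \<longlongrightarrow> 0) (at_right 0)"
    if "g \<in> l2 m" for g
  proof -
    have "(g, \<lambda>x. - L g x) \<in> generator m T" using that gen by blast
    then show ?thesis by (simp add: generator_def)
  qed
  let ?q = "\<lambda>h x. 1 / h * (T h f x - f x)"
  have q: "?q h \<in> l2 m" if "0 \<le> h" for h
    by (intro l2_scale l2_diff f C0_semigroup_D(5)[OF T that])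
  have *: "((\<lambda>h. l2_norm m (\<lambda>x. (T h (T t f) x - T t f x) / h - T t (\<lambda>x. - L f x) x)) \<longlongrightarrow> 0) (at_right 0)"
  proof (rule Lim_null_comparison)
    show "\<forall>\<^sub>F h in at_right 0. norm (l2_norm m (\<lambda>x. (T h (T t f) x - T t f x) / h - T t (\<lambda>x. - L f x) x))
        \<le> C * l2_norm m (\<lambda>x. (T h f x - f x) / h - - L f x)"
      using eventually_at_right_less[of 0]
    proof eventually_elim
      fix h :: real assume h: "0 < h"
      have d: "(\<lambda>x. ?q h x - - L f x) \<in> l2 m"
        using l2_diff(1)[OF q neg[OF f]] h by simp
      have "T h (T t f) = T t (T h f)"
        using C0_semigroup_D(3)[OF T t _ f, of h] C0_semigroup_D(3)[OF T _ t f, of h] h by (simp add: add.commute)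
      moreover have "T t (?q h) = (\<lambda>x. 1 / h * (T t (T h f) x - T t f x))"
        using l2_bounded_simps(2)[OF C l2_diff(1)[OF C0_semigroup_D(5)[OF T _ f] f], of h "1/h"]
          l2_bounded_simps(4)[OF C C0_semigroup_D(5)[OF T _ f] f, of h] h by simp
      ultimately have "T t (\<lambda>x. ?q h x - - L f x) = (\<lambda>x. (T h (T t f) x - T t f x) / h - T t (\<lambda>x. - L f x) x)"
        using l2_bounded_simps(4)[OF C q neg[OF f], of h] h by simp
      with l2_bounded_le[OF C d] l2_norm_nonneg[OF l2_bounded_le(1)[OF C d]]
      show "norm (l2_norm m (\<lambda>x. (T h (T t f) x - T t f x) / h - T t (\<lambda>x. - L f x) x))
        \<le> C * l2_norm m (\<lambda>x. (T h f x - f x) / h - - L f x)"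
        by simp
    qed
    show "((\<lambda>h. C * l2_norm m (\<lambda>x. (T h f x - f x) / h - - L f x)) \<longlongrightarrow> 0) (at_right 0)"
      by (rule tendsto_mult_right_zero[OF lim[OF f]])
  qed
  have "(T t f, T t (\<lambda>x. - L f x)) \<in> generator m T"
    using * Tf l2_bounded_le(1)[OF C neg[OF f]] by (simp add: generator_def)
  then have e: "T t (\<lambda>x. - L f x) = (\<lambda>x. - L (T t f) x)"
    using gen by blast
  have "T t (\<lambda>x. - 1 * L f x) = (\<lambda>x. - 1 * T t (L f) x)"
    by (rule l2_bounded_simps(2)[OF C l2_bounded_le(1)[OF bounded f]])
  with e have "(\<lambda>x. - L (T t f) x) = (\<lambda>x. - T t (L f) x)"
    by simp
  then show ?thesis
    by (simp add: fun_eq_iff)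
qed

text \<open>With \<open>h = t / n\<close> and \<open>E\<close> the exponential semigroup, \<open>T t - E t\<close> telescopes into \<open>n\<close> terms
  \<open>T (k h) (E ((n - 1 - k) h) (T h - E h))\<close>, where commutation moves the difference to the right. The
  outer factors are uniformly bounded, and \<open>T h f - E h f\<close> is \<open>o(h)\<close> because both semigroups have
  the same derivative at \<open>0\<close>; so the sum of the \<open>n = t / h\<close> terms tends to \<open>0\<close>.\<close>

lemma C0_semigroup_unique_near_0:
  assumes T: "C0_semigroup m T" and gen: "generator m T = {(f, \<lambda>x. - L f x) | f. f \<in> l2 m}"
    and B: "1 \<le> B" "\<And>s. 0 \<le> s \<Longrightarrow> s \<le> t \<Longrightarrow> l2_bounded m B (T s)"
    and t: "0 < t" and f: "f \<in> l2 m"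
  shows "T t f = operator_exp L (- t) f"
proof -
  let ?E = "\<lambda>s. operator_exp L (- s)"
  define d where "d h = l2_norm m (\<lambda>x. T h f x - ?E h f x)" for h
  have Ef: "?E s g \<in> l2 m" if "g \<in> l2 m" for s g
    by (rule operator_exp_remainder(1)[OF that])
  have Tf: "T s g \<in> l2 m" if "g \<in> l2 m" "0 \<le> s" for s g
    using C0_semigroup_D(5)[OF T] that by blast
  have d_nonneg: "0 \<le> d h" if "0 \<le> h" for h
    unfolding d_def using that by (intro l2_norm_nonneg l2_diff Ef Tf f)
  have telescope: "l2_norm m (\<lambda>x. T (real k * h) f x - ?E (real k * h) f x) \<le> real k * B * exp (real k * h * M) * d h"
    if h: "0 \<le> h" and k: "real k * h \<le> t" for k h
    using k
  proof (induction k)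
    case 0
    then show ?case using C0_semigroup_D(2)[OF T f] by (simp add: operator_exp_zero l2_zero)
  next
    case (Suc k)
    let ?s = "real k * h"
    have s: "0 \<le> ?s" "?s \<le> t" using Suc.prems h by (auto simp: algebra_simps)
    have Bk: "l2_bounded m B (T ?s)" using B(2)[OF s] .
    have T1: "T (real (Suc k) * h) f = T ?s (T h f)"
      using C0_semigroup_D(3)[OF T s(1) h f] by (simp add: algebra_simps)
    have E1: "?E (real (Suc k) * h) f = ?E h (?E ?s f)"
      using operator_exp_add[OF f, of "- h" "- ?s"] by (simp add: algebra_simps)
    have com: "T ?s (?E h f) = ?E h (T ?s f)"
      using operator_exp_commute[OF Bk C0_semigroup_commute_generator[OF T gen s(1)] f] .
    have l1: "(\<lambda>x. T h f x - ?E h f x) \<in> l2 m" "(\<lambda>x. T ?s f x - ?E ?s f x) \<in> l2 m"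
      using h s by (intro l2_diff Tf Ef f; simp)+
    have "l2_norm m (\<lambda>x. T ?s (T h f) x - ?E h (?E ?s f) x)
        \<le> l2_norm m (\<lambda>x. T ?s (T h f) x - T ?s (?E h f) x) + l2_norm m (\<lambda>x. ?E h (T ?s f) x - ?E h (?E ?s f) x)"
      using l2_norm_triangle[of "T ?s (T h f)" "T ?s (?E h f)" "?E h (?E ?s f)"] com Tf Ef f h s by simp
    also have "l2_norm m (\<lambda>x. T ?s (T h f) x - T ?s (?E h f) x) \<le> B * d h"
      unfolding d_def using l2_bounded_le(2)[OF Bk l1(1)] l2_bounded_simps(4)[OF Bk Tf[OF f h] Ef[OF f, of h]]
      by simp
    also have "l2_norm m (\<lambda>x. ?E h (T ?s f) x - ?E h (?E ?s f) x)
        \<le> exp (h * M) * (real k * B * exp (?s * M) * d h)"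
    proof -
      have "l2_norm m (\<lambda>x. ?E h (T ?s f) x - ?E h (?E ?s f) x)
          \<le> exp (\<bar>- h\<bar> * M) * l2_norm m (\<lambda>x. T ?s f x - ?E ?s f x)"
        using l2_bounded_le(2)[OF operator_exp_bounded l1(2), of "- h"]
          l2_bounded_simps(4)[OF operator_exp_bounded Tf[OF f s(1)] Ef[OF f, of ?s], of "- h"]
        by simp
      also have "\<dots> \<le> exp (\<bar>- h\<bar> * M) * (real k * B * exp (?s * M) * d h)"
        using Suc.IH[OF s(2)] by (intro mult_left_mono) auto
      finally show ?thesis using h by simp
    qed
    also have "B * d h + exp (h * M) * (real k * B * exp (?s * M) * d h)
        \<le> real (Suc k) * B * exp (real (Suc k) * h * M) * d h"
    proof -
      have "exp (h * M) * exp (?s * M) = exp (real (Suc k) * h * M)"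
        by (simp add: exp_add[symmetric] algebra_simps)
      moreover have "B * d h * 1 \<le> B * d h * exp (real (Suc k) * h * M)"
        using B(1) d_nonneg[OF h] h M_nonneg by (intro mult_left_mono) auto
      ultimately show ?thesis by (simp add: algebra_simps)
    qed
    finally show ?case unfolding T1 E1 by simp
  qed
  have lim: "((\<lambda>h. d h / h) \<longlongrightarrow> 0) (at_right 0)"
  proof (rule Lim_null_comparison)
    let ?a = "\<lambda>h. l2_norm m (\<lambda>x. (T h f x - f x) / h - - L f x)"
    let ?b = "\<lambda>h. l2_norm m (\<lambda>x. (?E h f x - f x) / h - - L f x)"
    have "(f, \<lambda>x. - L f x) \<in> generator m T" "(f, \<lambda>x. - L f x) \<in> generator m ?E"
      using gen operator_exp_semigroup(2) f by blast+
    then have "((\<lambda>h. ?a h + ?b h) \<longlongrightarrow> 0 + 0) (at_right 0)"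
      by (intro tendsto_add) (auto simp: generator_def)
    then show "((\<lambda>h. ?a h + ?b h) \<longlongrightarrow> 0) (at_right 0)" by simp
    show "\<forall>\<^sub>F h in at_right 0. norm (d h / h) \<le> ?a h + ?b h"
      using eventually_at_right_less[of 0]
    proof eventually_elim
      fix h :: real assume h: "0 < h"
      have q: "(\<lambda>x. (u x - f x) / h - - L f x) \<in> l2 m" if "u \<in> l2 m" for u
        using l2_add(1)[OF l2_scale(1)[OF l2_diff(1)[OF that f], of "1/h"] l2_bounded_le(1)[OF bounded f]] by simp
      have "norm (d h / h) = l2_norm m (\<lambda>x. 1 / h * (T h f x - ?E h f x))"
        using l2_scale(2)[OF l2_diff(1)[OF Tf[OF f, of h] Ef[OF f, of h]], of "1/h"] h d_nonneg[of h]
        by (simp add: d_def)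
      also have "(\<lambda>x. 1 / h * (T h f x - ?E h f x)) =
          (\<lambda>x. ((T h f x - f x) / h - - L f x) - ((?E h f x - f x) / h - - L f x))"
        by (simp add: diff_divide_distrib)
      also have "l2_norm m \<dots> \<le> ?a h + ?b h"
        using l2_diff(2)[OF q[OF Tf[OF f]] q[OF Ef[OF f]], of h h] h by simp
      finally show "norm (d h / h) \<le> ?a h + ?b h" .
    qed
  qed
  have step: "filterlim (\<lambda>n. t / real (Suc n)) (at_right 0) sequentially"
  proof (rule tendsto_imp_filterlim_at_right)
    show "(\<lambda>n. t / real (Suc n)) \<longlonglongrightarrow> 0"
      using tendsto_mult_right_zero[OF LIMSEQ_inverse_real_of_nat, of t] by (simp add: divide_inverse)
  qed (use t in auto)
  have lim': "(\<lambda>n. B * exp (t * M) * t * (d (t / real (Suc n)) / (t / real (Suc n)))) \<longlonglongrightarrow> 0"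
    by (rule tendsto_mult_right_zero[OF filterlim_compose[OF lim step]])
  have le: "l2_norm m (\<lambda>x. T t f x - ?E t f x) \<le> B * exp (t * M) * t * (d (t / real (Suc n)) / (t / real (Suc n)))" for n
    using telescope[of "t / real (Suc n)" "Suc n"] t by (simp add: mult_ac)
  have "l2_norm m (\<lambda>x. T t f x - ?E t f x) \<le> 0"
    by (rule tendsto_lowerbound[OF lim']) (use le in auto)
  then have "l2_norm m (\<lambda>x. T t f x - ?E t f x) = 0"
    using l2_norm_nonneg[OF l2_diff(1)[OF Tf[OF f, of t] Ef[OF f, of t]]] t by simp
  then have "T t f x - ?E t f x = 0" for x
    using abs_le_l2_norm[OF l2_diff(1)[OF Tf[OF f, of t] Ef[OF f, of t]], of x] t by simp
  then show ?thesis by fastforce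
qed

text \<open>Every time is a multiple of one close to \<open>0\<close>, where the semigroups agree.\<close>

theorem C0_semigroup_unique:
  assumes T: "C0_semigroup m T" and gen: "generator m T = {(f, \<lambda>x. - L f x) | f. f \<in> l2 m}"
    and t: "0 \<le> t" and f: "f \<in> l2 m"
  shows "T t f = operator_exp L (- t) f"
proof -
  obtain \<delta> B where \<delta>: "0 < \<delta>" "1 \<le> B" "\<And>s. 0 \<le> s \<Longrightarrow> s \<le> \<delta> \<Longrightarrow> l2_bounded m B (T s)"
    using C0_semigroup_bounded_near_0[OF T] by blast
  have small: "T s f = operator_exp L (- s) f" if "0 \<le> s" "s \<le> \<delta>" "f \<in> l2 m" for s f
  proof (cases "s = 0")
    case True
    then show ?thesis using C0_semigroup_D(2)[OF T] that by (simp add: operator_exp_zero)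
  next
    case False
    then show ?thesis using C0_semigroup_unique_near_0[OF T gen \<delta>(2)] \<delta>(3) that by simp
  qed
  obtain n where n: "t / \<delta> \<le> real n" using real_arch_simple by blast
  define s where "s = t / real (Suc n)"
  have s: "0 \<le> s" "s \<le> \<delta>"
    using n t \<delta>(1) by (auto simp: s_def field_simps intro: order_trans)
  have "T (real k * s) f = operator_exp L (- (real k * s)) f" for k
  proof (induction k)
    case 0
    then show ?case using C0_semigroup_D(2)[OF T f] by (simp add: operator_exp_zero)
  next
    case (Suc k)
    have "T (real (Suc k) * s) f = T s (T (real k * s) f)"
      using C0_semigroup_D(3)[OF T s(1) _ f, of "real k * s"] s by (simp add: algebra_simps)
    also have "\<dots> = operator_exp L (- s) (operator_exp L (- (real k * s)) f)"
      unfolding Suc using small[OF s operator_exp_remainder(1)[OF f]] .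
    also have "\<dots> = operator_exp L (- (real (Suc k) * s)) f"
      using operator_exp_add[OF f, of "- s" "- (real k * s)"] by (simp add: algebra_simps)
    finally show ?case .
  qed
  from this[of "Suc n"] show ?thesis by (simp add: s_def)
qed

text \<open>Existence and uniqueness of the semigroup turn the definite description into a series.\<close>

theorem exp_semigroup_eq_operator_exp:
  assumes "0 \<le> t" "f \<in> l2 m"
  shows "exp_semigroup m {(f, L f) | f. f \<in> l2 m} t f = operator_exp L (- t) f"
proof -
  have gen: "{(g, \<lambda>x. - h x) | g h. (g, h) \<in> {(f, L f) | f. f \<in> l2 m}} = {(f, \<lambda>x. - L f x) | f. f \<in> l2 m}"
    by auto
  show ?thesis
    unfolding exp_semigroup_def gen
    by (rule the_equality) (use operator_exp_semigroup C0_semigroup_unique assms in blast)+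
qed

end

section \<open>The closed Dirichlet form\<close>

locale graph =
  fixes b :: "'v \<Rightarrow> 'v \<Rightarrow> real" and m :: "'v \<Rightarrow> real"
  assumes weighted_graph: "weighted_graph b m"
begin

lemma b_nonneg: "0 \<le> b x y"
  and b_sym: "b x y = b y x"
  and b_diag: "b x x = 0"
  and m_pos: "0 < m x"
  and finite_neighbours: "finite {y. b x y \<noteq> 0}"
proof -
  have "\<forall>x y. 0 \<le> b x y" "\<forall>x. finite {y. b x y > 0}"
    using weighted_graph by (auto simp: weighted_graph_def locally_finite_def)
  moreover from this have "{y. b x y \<noteq> 0} = {y. b x y > 0}"
    by (auto simp: less_le)
  ultimately show "finite {y. b x y \<noteq> 0}" by simp
qed (use weighted_graph in \<open>auto simp: weighted_graph_def\<close>)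

end

sublocale graph \<subseteq> positive_weight m
  by unfold_locales (rule m_pos)

sublocale graph \<subseteq> edges: weight "\<lambda>(x, y). b x y"
  by unfold_locales (auto simp: b_nonneg)

context graph
begin

abbreviation L where "L \<equiv> formal_laplacian b m"

text \<open>The energy form is half of the inner product of gradients in the space with weight \<open>b\<close> on
  pairs of vertices, so its Cauchy-Schwarz inequality and its lower semicontinuity are those of a
  weighted sequence space.\<close>

definition grad :: "('v \<Rightarrow> real) \<Rightarrow> 'v \<times> 'v \<Rightarrow> real" where
  "grad f = (\<lambda>(x, y). f x - f y)"

abbreviation edge_weight :: "'v \<times> 'v \<Rightarrow> real" where
  "edge_weight \<equiv> (\<lambda>(x, y). b x y)"

lemma energy_eq: "energy b f g = l2_inner edge_weight (grad f) (grad g) / 2"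
  unfolding energy_def l2_inner_def grad_def
  by (simp add: case_prod_unfold mult_ac)

lemma energy_self: "energy b f f = (l2_norm edge_weight (grad f))\<^sup>2 / 2"
proof -
  have "0 \<le> l2_inner edge_weight (grad f) (grad f)"
    unfolding l2_inner_def by (rule infsum_nonneg) (auto simp: b_nonneg)
  then show ?thesis
    by (simp add: energy_eq l2_norm_def)
qed

lemma formal_laplacian_eq:
  "L f x = 1 / m x * (\<Sum>y | b x y \<noteq> 0. b x y * (f x - f y))"
proof -
  have "(\<Sum>\<^sub>\<infinity>y. b x y * (f x - f y)) = (\<Sum>\<^sub>\<infinity>y\<in>{y. b x y \<noteq> 0}. b x y * (f x - f y))"
    by (rule infsum_cong_neutral) auto
  then show ?thesis
    unfolding formal_laplacian_def using finite_neighbours by simp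
qed

lemma grad_Cc:
  assumes "f \<in> Cc"
  shows "grad f \<in> l2 edge_weight"
proof -
  let ?S = "{x. f x \<noteq> 0}"
  let ?E = "(SIGMA x:?S. {y. b x y \<noteq> 0}) \<union> prod.swap ` (SIGMA x:?S. {y. b x y \<noteq> 0})"
  have "finite ?E"
    using assms finite_neighbours by (auto simp: Cc_def)
  moreover have "{p. (grad f p)\<^sup>2 * edge_weight p \<noteq> 0} \<subseteq> ?E"
    using b_sym by (force simp: grad_def image_iff)
  ultimately have "finite {p. (grad f p)\<^sup>2 * edge_weight p \<noteq> 0}"
    by (rule rev_finite_subset)
  then show ?thesis
    unfolding l2_def mem_Collect_eq summable_on_def
    by (intro exI has_sum_finite_neutralI[where B = "{p. (grad f p)\<^sup>2 * edge_weight p \<noteq> 0}"]) auto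
qed

lemma Cc_indicator: "(indicator {y} :: 'v \<Rightarrow> real) \<in> Cc"
  by (simp add: Cc_def indicator_def)

lemma grad_diff: "grad (\<lambda>x. f x - g x) = (\<lambda>p. grad f p - grad g p)"
  by (auto simp: grad_def)

text \<open>Only the pairs \<open>(x, y)\<close> and \<open>(y, x)\<close> contribute, with equal amounts, which cancels the
  factor \<open>1/2\<close>.\<close>

lemma energy_indicator:
  "energy b f (indicator {x}) = m x * L f x"
proof -
  let ?N = "{y. b x y \<noteq> 0}"
  let ?F = "Pair x ` ?N \<union> (\<lambda>y. (y, x)) ` ?N"
  let ?h = "\<lambda>(u, v). b u v * (f u - f v) * (indicator {x} u - indicator {x} v)"
  have "(\<Sum>\<^sub>\<infinity>p. ?h p) = (\<Sum>\<^sub>\<infinity>p\<in>?F. ?h p)"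
    by (rule infsum_cong_neutral) (auto simp: indicator_def image_iff, (metis b_sym)+)
  also have "\<dots> = (\<Sum>p\<in>?F. ?h p)"
    using finite_neighbours by simp
  also have "\<dots> = (\<Sum>p\<in>Pair x ` ?N. ?h p) + (\<Sum>p\<in>(\<lambda>y. (y, x)) ` ?N. ?h p)"
    using finite_neighbours b_diag by (intro sum.union_disjoint) auto
  also have "(\<Sum>p\<in>Pair x ` ?N. ?h p) = (\<Sum>y\<in>?N. b x y * (f x - f y))"
    by (subst sum.reindex) (auto simp: inj_on_def indicator_def b_diag intro!: sum.cong)
  also have "(\<Sum>p\<in>(\<lambda>y. (y, x)) ` ?N. ?h p) = (\<Sum>y\<in>?N. b x y * (f x - f y))"
    by (subst sum.reindex)
      (auto simp: inj_on_def indicator_def b_diag b_sym[of _ x] algebra_simps intro!: sum.cong)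
  finally show ?thesis
    using m_pos[of x] by (simp add: energy_def formal_laplacian_eq)
qed

lemma form_approx_Cauchy:
  assumes "form_approx b m \<phi> f" "0 < \<epsilon>"
  shows "\<exists>N. \<forall>i\<ge>N. \<forall>j\<ge>N. l2_norm edge_weight (\<lambda>p. grad (\<phi> i) p - grad (\<phi> j) p) < \<epsilon>"
proof -
  have "0 < \<epsilon>\<^sup>2 / 2" using assms(2) by simp
  then obtain N where N: "\<And>i j. i \<ge> N \<Longrightarrow> j \<ge> N \<Longrightarrow>
      energy b (\<lambda>x. \<phi> i x - \<phi> j x) (\<lambda>x. \<phi> i x - \<phi> j x) < \<epsilon>\<^sup>2 / 2"
    using assms(1) unfolding form_approx_def by meson
  have "l2_norm edge_weight (\<lambda>p. grad (\<phi> i) p - grad (\<phi> j) p) < \<epsilon>" if "i \<ge> N" "j \<ge> N" for i j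
    using N[OF that] assms(2) unfolding energy_self grad_diff
    by (simp add: power_less_imp_less_base less_imp_le)
  then show ?thesis by blast
qed

text \<open>Convergence in \<open>l2 m\<close> implies pointwise convergence of functions and of gradients. Fixing one
  index of the Cauchy condition and letting the other tend to infinity, the Fatou property bounds the
  distance to the gradient of the limit.\<close>

lemma form_closable:
  assumes \<phi>: "form_approx b m \<phi> f"
  shows "grad f \<in> l2 edge_weight"
    and "(\<lambda>n. l2_norm edge_weight (\<lambda>p. grad (\<phi> n) p - grad f p)) \<longlonglongrightarrow> 0"
proof -
  have Cc: "\<phi> n \<in> Cc" for n
    using \<phi> by (auto simp: form_approx_def)
  have f: "f \<in> l2 m"
    using \<phi> by (auto simp: form_approx_def)
  have "(\<lambda>n. \<phi> n x) \<longlonglongrightarrow> f x" for x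
    by (rule l2_norm_tendsto_pointwise) (use \<phi> Cc_subset_l2 Cc f in \<open>auto simp: form_approx_def\<close>)
  then have pt: "(\<lambda>n. grad (\<phi> n) p) \<longlonglongrightarrow> grad f p" for p
    unfolding grad_def by (auto simp: case_prod_unfold intro: tendsto_diff)
  have *: "\<exists>N. \<forall>n\<ge>N. (\<lambda>p. grad (\<phi> n) p - grad f p) \<in> l2 edge_weight \<and>
      l2_norm edge_weight (\<lambda>p. grad (\<phi> n) p - grad f p) \<le> \<epsilon>" if \<epsilon>: "0 < \<epsilon>" for \<epsilon>
  proof -
    obtain N where N: "\<And>i j. i \<ge> N \<Longrightarrow> j \<ge> N \<Longrightarrow>
        l2_norm edge_weight (\<lambda>p. grad (\<phi> i) p - grad (\<phi> j) p) < \<epsilon>"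
      using form_approx_Cauchy[OF \<phi> \<epsilon>] by blast
    show ?thesis
    proof (intro exI allI impI)
      fix n assume n: "N \<le> n"
      have lim: "(\<lambda>k. grad (\<phi> n) p - grad (\<phi> k) p) \<longlonglongrightarrow> grad (\<phi> n) p - grad f p" for p
        by (intro tendsto_intros pt)
      have ev: "\<forall>\<^sub>F k in sequentially. (\<lambda>p. grad (\<phi> n) p - grad (\<phi> k) p) \<in> l2 edge_weight \<and>
          l2_norm edge_weight (\<lambda>p. grad (\<phi> n) p - grad (\<phi> k) p) \<le> \<epsilon>"
        using eventually_ge_at_top[of N]
        by eventually_elim (use N[OF n] edges.l2_diff(1) grad_Cc Cc in \<open>auto intro: less_imp_le\<close>)
      show "(\<lambda>p. grad (\<phi> n) p - grad f p) \<in> l2 edge_weight \<and>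
          l2_norm edge_weight (\<lambda>p. grad (\<phi> n) p - grad f p) \<le> \<epsilon>"
        using edges.l2_Fatou[OF lim ev] by blast
    qed
  qed
  obtain n where n: "(\<lambda>p. grad (\<phi> n) p - grad f p) \<in> l2 edge_weight"
    using *[of 1] by auto
  show gf: "grad f \<in> l2 edge_weight"
    using edges.l2_diff(1)[OF grad_Cc[OF Cc[of n]] n] by simp
  show "(\<lambda>n. l2_norm edge_weight (\<lambda>p. grad (\<phi> n) p - grad f p)) \<longlonglongrightarrow> 0"
  proof (rule LIMSEQ_I)
    fix r :: real assume r: "0 < r"
    then obtain N where N: "\<forall>n\<ge>N. l2_norm edge_weight (\<lambda>p. grad (\<phi> n) p - grad f p) \<le> r / 2"
      using *[of "r / 2"] by auto
    have "norm (l2_norm edge_weight (\<lambda>p. grad (\<phi> n) p - grad f p) - 0) < r" if "n \<ge> N" for n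
      using N that r edges.l2_norm_nonneg[OF edges.l2_diff(1)[OF grad_Cc[OF Cc[of n]] gf]]
      by (fastforce simp: abs_of_nonneg)
    then show "\<exists>no. \<forall>n\<ge>no. norm (l2_norm edge_weight (\<lambda>p. grad (\<phi> n) p - grad f p) - 0) < r"
      by blast
  qed
qed

lemma energy_form_approx_tendsto:
  assumes \<phi>: "form_approx b m \<phi> f" and \<psi>: "form_approx b m \<psi> g"
  shows "(\<lambda>n. energy b (\<phi> n) (\<psi> n)) \<longlonglongrightarrow> energy b f g"
proof -
  let ?n = "l2_norm edge_weight"
  note F = form_closable[OF \<phi>] and G = form_closable[OF \<psi>]
  have P: "grad (\<phi> n) \<in> l2 edge_weight" "grad (\<psi> n) \<in> l2 edge_weight" for n
    using \<phi> \<psi> grad_Cc by (auto simp: form_approx_def)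
  have "(\<lambda>n. energy b (\<phi> n) (\<psi> n) - energy b f g) \<longlonglongrightarrow> 0"
  proof (rule Lim_null_comparison)
    let ?\<alpha> = "\<lambda>n. ?n (\<lambda>p. grad (\<phi> n) p - grad f p)" and ?\<beta> = "\<lambda>n. ?n (\<lambda>p. grad (\<psi> n) p - grad g p)"
    have "(\<lambda>n. ((?\<alpha> n + ?n (grad f)) * ?\<beta> n + ?n (grad g) * ?\<alpha> n) / 2) \<longlonglongrightarrow>
        ((0 + ?n (grad f)) * 0 + ?n (grad g) * 0) / 2"
      by (intro tendsto_intros F(2) G(2)) auto
    then show "(\<lambda>n. ((?\<alpha> n + ?n (grad f)) * ?\<beta> n + ?n (grad g) * ?\<alpha> n) / 2) \<longlonglongrightarrow> 0" by simp
    have "norm (energy b (\<phi> n) (\<psi> n) - energy b f g)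
        \<le> ((?\<alpha> n + ?n (grad f)) * ?\<beta> n + ?n (grad g) * ?\<alpha> n) / 2" for n
    proof -
      let ?I = "l2_inner edge_weight"
      have combine: "\<bar>e\<bar> \<le> (u' + v') / 2"
        if "e = (u + v) / 2" "\<bar>u\<bar> \<le> a" "a \<le> u'" "\<bar>v\<bar> \<le> v'" for e u v a u' v' :: real
        unfolding that(1) using that(2-) abs_triangle_ineq[of u v] by simp
      have com: "?I u v = ?I v u" for u v
        unfolding l2_inner_def by (simp add: mult_ac)
      have d: "(\<lambda>p. grad (\<phi> n) p - grad f p) \<in> l2 edge_weight" "(\<lambda>p. grad (\<psi> n) p - grad g p) \<in> l2 edge_weight"
        using edges.l2_diff(1) P F(1) G(1) by blast+
      have "energy b (\<phi> n) (\<psi> n) - energy b f g =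
         (?I (grad (\<phi> n)) (\<lambda>p. grad (\<psi> n) p - grad g p) + ?I (grad g) (\<lambda>p. grad (\<phi> n) p - grad f p)) / 2"
        using edges.l2_inner_diff_right[OF P(1) P(2) G(1), of n n] edges.l2_inner_diff_right[OF G(1) P(1) F(1), of n]
        by (simp add: energy_eq com[of "grad g"])
      moreover have "\<bar>?I (grad (\<phi> n)) (\<lambda>p. grad (\<psi> n) p - grad g p)\<bar> \<le> ?n (grad (\<phi> n)) * ?\<beta> n"
        by (rule edges.l2_Cauchy_Schwarz(2)[OF P(1) d(2)])
      moreover have "?n (grad (\<phi> n)) * ?\<beta> n \<le> (?\<alpha> n + ?n (grad f)) * ?\<beta> n"
        using edges.l2_norm_diff_ge[OF P(1) F(1), of n] edges.l2_norm_nonneg[OF d(2)]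
        by (intro mult_right_mono) auto
      moreover have "\<bar>?I (grad g) (\<lambda>p. grad (\<phi> n) p - grad f p)\<bar> \<le> ?n (grad g) * ?\<alpha> n"
        by (rule edges.l2_Cauchy_Schwarz(2)[OF G(1) d(1)])
      ultimately show ?thesis unfolding real_norm_def by (rule combine)
    qed
    then show "\<forall>\<^sub>F n in sequentially. norm (energy b (\<phi> n) (\<psi> n) - energy b f g)
        \<le> ((?\<alpha> n + ?n (grad f)) * ?\<beta> n + ?n (grad g) * ?\<alpha> n) / 2"
      by (intro always_eventually allI)
  qed
  then show ?thesis by (rule LIM_zero_cancel)
qed

text \<open>Gradients of approximating sequences converge in norm, so their energies converge to the same
  value whatever the sequences; this makes the definite description denote that value.\<close>

lemma form_closure_eq_energy:
  assumes f: "f \<in> form_domain b m" and g: "g \<in> form_domain b m"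
  shows "form_closure b m f g = energy b f g"
  unfolding form_closure_def
proof (rule the_equality)
  show "\<forall>\<phi> \<psi>. form_approx b m \<phi> f \<longrightarrow> form_approx b m \<psi> g \<longrightarrow>
      (\<lambda>n. energy b (\<phi> n) (\<psi> n)) \<longlonglongrightarrow> energy b f g"
    using energy_form_approx_tendsto by blast
  obtain \<phi> \<psi> where a: "form_approx b m \<phi> f" "form_approx b m \<psi> g"
    using f g by (auto simp: form_domain_def)
  fix q
  assume "\<forall>\<phi> \<psi>. form_approx b m \<phi> f \<longrightarrow> form_approx b m \<psi> g \<longrightarrow>
      (\<lambda>n. energy b (\<phi> n) (\<psi> n)) \<longlonglongrightarrow> q"
  with a have "(\<lambda>n. energy b (\<phi> n) (\<psi> n)) \<longlonglongrightarrow> q" by blast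
  then show "q = energy b f g"
    using energy_form_approx_tendsto[OF a] by (rule LIMSEQ_unique)
qed

lemma indicator_form_domain: "indicator {x} \<in> form_domain b m"
proof -
  have "form_approx b m (\<lambda>_. indicator {x}) (indicator {x})"
    using l2_norm_indicator(1) l2_zero(2) Cc_indicator by (simp add: form_approx_def energy_def case_prod_unfold)
  then show ?thesis unfolding form_domain_def by blast
qed

lemma l2_inner_indicator: "l2_inner m h (indicator {x}) = h x * m x"
proof -
  have "((\<lambda>y. h y * indicator {x} y * m y) has_sum h x * m x) UNIV"
    by (rule has_sum_finite_neutralI[where B = "{x}"]) auto
  then show ?thesis unfolding l2_inner_def by (rule infsumI)
qed

text \<open>Test the defining identity of the Friedrichs extension with indicator functions of vertices.\<close>

lemma laplacian_formal:
  assumes "(f, h) \<in> laplacian b m"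
  shows "h = L f"
proof
  fix x
  have "h x * m x = form_closure b m f (indicator {x})"
    using assms indicator_form_domain[of x] by (simp add: laplacian_def l2_inner_indicator)
  also have "\<dots> = m x * L f x"
    using assms indicator_form_domain[of x]
    by (simp add: form_closure_eq_energy energy_indicator laplacian_def)
  finally show "h x = L f x" using m_pos[of x] by simp
qed

lemma formal_laplacian_linear:
  "L (\<lambda>x. c * f x + d * g x) = (\<lambda>x. c * L f x + d * L g x)"
  unfolding formal_laplacian_eq
  by (auto simp: sum_distrib_left sum.distrib[symmetric] algebra_simps intro!: sum.cong)

end

section \<open>Bounded Laplacians and the Feller property\<close>

locale bounded_graph = graph b m for b :: "'v \<Rightarrow> 'v \<Rightarrow> real" and m :: "'v \<Rightarrow> real" +
  fixes M :: real
  assumes domain: "Domain (laplacian b m) = l2 m"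
    and laplacian_le: "(f, h) \<in> laplacian b m \<Longrightarrow> l2_norm m h \<le> M * l2_norm m f"
    and M_nonneg: "0 \<le> M"
begin

lemma formal_in_laplacian:
  assumes "f \<in> l2 m"
  shows "(f, L f) \<in> laplacian b m"
  using assms laplacian_formal domain by blast

lemma laplacian_eq: "laplacian b m = {(f, L f) | f. f \<in> l2 m}"
proof (intro equalityI subsetI)
  fix p assume p: "p \<in> laplacian b m"
  moreover obtain f h where fh: "p = (f, h)" by fastforce
  moreover have "f \<in> l2 m" using p domain unfolding fh by blast
  ultimately show "p \<in> {(f, L f) | f. f \<in> l2 m}"
    using laplacian_formal[of f h] by blast
qed (use formal_in_laplacian in auto)

end

sublocale bounded_graph \<subseteq> bounded_operator m M "formal_laplacian b m"
proof
  show "l2_bounded m M L"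
    unfolding l2_bounded_def
  proof (intro conjI ballI allI)
    fix f assume "f \<in> l2 m"
    then have "(f, L f) \<in> laplacian b m" by (rule formal_in_laplacian)
    then show "L f \<in> l2 m" "l2_norm m (L f) \<le> M * l2_norm m f"
      using laplacian_le by (auto simp: laplacian_def)
  qed (rule formal_laplacian_linear)
qed (rule M_nonneg)

context bounded_graph
begin

text \<open>The value of the Laplacian of an indicator function at its own vertex is the weighted degree
  divided by the measure, so a bounded operator forces bounded degrees.\<close>

lemma degree_le: "(\<Sum>y | b x y \<noteq> 0. b x y) \<le> M * m x"
proof -
  let ?e = "indicator {x} :: 'v \<Rightarrow> real"
  have "(\<Sum>y | b x y \<noteq> 0. b x y) / m x = L ?e x"
    by (auto simp: formal_laplacian_eq b_diag indicator_def intro!: arg_cong2[where f = "(/)"] sum.cong)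
  also have "\<dots> \<le> l2_norm m (L ?e) / sqrt (m x)"
    using abs_le_l2_norm[OF l2_bounded_le(1)[OF bounded l2_norm_indicator(1)], of x x] by linarith
  also have "\<dots> \<le> M * sqrt (m x) / sqrt (m x)"
    using l2_bounded_le(2)[OF bounded l2_norm_indicator(1), of x] m_pos[of x]
    by (intro divide_right_mono) (auto simp: l2_norm_indicator)
  also have "\<dots> = M" using m_pos[of x] by simp
  finally show ?thesis using m_pos[of x] by (simp add: field_simps)
qed

text \<open>Besides \<open>l2 m\<close>, the supremum norm is the one in which the exponential series is estimated. The
  factor \<open>2\<close> comes from the two values in each difference.\<close>

lemma formal_laplacian_sup_le:
  assumes f: "\<And>x. \<bar>f x\<bar> \<le> K"
  shows "\<bar>L f x\<bar> \<le> 2 * M * K"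
proof -
  have K: "0 \<le> K" using f[of x] by linarith
  have "\<bar>\<Sum>y | b x y \<noteq> 0. b x y * (f x - f y)\<bar> \<le> (\<Sum>y | b x y \<noteq> 0. \<bar>b x y * (f x - f y)\<bar>)"
    by (rule sum_abs)
  also have "\<dots> \<le> (\<Sum>y | b x y \<noteq> 0. b x y * (2 * K))"
  proof (rule sum_mono)
    fix y
    have "\<bar>f x - f y\<bar> \<le> 2 * K" using f[of x] f[of y] by linarith
    then show "\<bar>b x y * (f x - f y)\<bar> \<le> b x y * (2 * K)"
      using b_nonneg[of x y] by (auto simp: abs_mult intro!: mult_left_mono)
  qed
  also have "\<dots> = (\<Sum>y | b x y \<noteq> 0. b x y) * (2 * K)"
    by (simp add: sum_distrib_right)
  also have "\<dots> \<le> M * m x * (2 * K)"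
    using degree_le K by (intro mult_right_mono) auto
  finally show ?thesis
    using m_pos[of x] by (simp add: formal_laplacian_eq abs_mult field_simps)
qed

lemma formal_laplacian_power_sup_le:
  assumes f: "\<And>x. \<bar>f x\<bar> \<le> K"
  shows "\<bar>(L ^^ k) f x\<bar> \<le> (2 * M) ^ k * K"
proof (induction k arbitrary: x)
  case (Suc k)
  then show ?case
    using formal_laplacian_sup_le[of "(L ^^ k) f" "(2 * M) ^ k * K" x] by (simp add: mult_ac)
qed (use f in simp)

lemma formal_laplacian_Cc:
  assumes "f \<in> Cc"
  shows "L f \<in> Cc"
proof -
  let ?S = "{x. f x \<noteq> 0}"
  have "{x. L f x \<noteq> 0} \<subseteq> ?S \<union> (\<Union>x\<in>?S. {y. b x y \<noteq> 0})"
  proof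
    fix x assume "x \<in> {x. L f x \<noteq> 0}"
    then have "(\<Sum>y | b x y \<noteq> 0. b x y * (f x - f y)) \<noteq> 0"
      by (auto simp: formal_laplacian_eq)
    then obtain y where "b x y \<noteq> 0" "f x - f y \<noteq> 0"
      by (metis (mono_tags, lifting) mem_Collect_eq mult_zero_right sum.neutral)
    then show "x \<in> ?S \<union> (\<Union>x\<in>?S. {y. b x y \<noteq> 0})"
      using b_sym[of x y] by auto
  qed
  moreover have "finite (?S \<union> (\<Union>x\<in>?S. {y. b x y \<noteq> 0}))"
    using assms finite_neighbours by (auto simp: Cc_def)
  ultimately show ?thesis
    unfolding Cc_def using finite_subset by blast
qed

text \<open>By local finiteness each application of the Laplacian enlarges a finite support to a finite
  set.\<close>

lemma exp_partial_sum_Cc: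
  assumes "f \<in> Cc"
  shows "(\<lambda>x. \<Sum>k<n. exp_term t f k x) \<in> Cc"
proof -
  have "(L ^^ k) f \<in> Cc" for k
    by (induction k) (auto simp: assms formal_laplacian_Cc)
  then have "finite (\<Union>k<n. {x. (L ^^ k) f x \<noteq> 0})"
    by (auto simp: Cc_def)
  moreover have "{x. (\<Sum>k<n. exp_term t f k x) \<noteq> 0} \<subseteq> (\<Union>k<n. {x. (L ^^ k) f x \<noteq> 0})"
  proof (rule subsetI, rule ccontr)
    fix x assume x: "x \<in> {x. (\<Sum>k<n. exp_term t f k x) \<noteq> 0}"
      and no: "x \<notin> (\<Union>k<n. {x. (L ^^ k) f x \<noteq> 0})"
    have "(\<Sum>k<n. exp_term t f k x) = 0"
      by (rule sum.neutral) (use no in auto)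
    with x show False by simp
  qed
  ultimately show ?thesis
    unfolding Cc_def using finite_subset by blast
qed

lemma operator_exp_sup_remainder:
  assumes f: "\<And>x. \<bar>f x\<bar> \<le> K"
  shows "\<bar>operator_exp L t f x - (\<Sum>k<n. exp_term t f k x)\<bar>
    \<le> (exp (2 * M * \<bar>t\<bar>) - (\<Sum>k<n. (2 * M * \<bar>t\<bar>) ^ k / fact k)) * K"
proof -
  let ?z = "2 * M * \<bar>t\<bar>"
  have le: "\<bar>exp_term t f k x\<bar> \<le> ?z ^ k / fact k * K" for k
  proof -
    have "\<bar>exp_term t f k x\<bar> = \<bar>t\<bar> ^ k / fact k * \<bar>(L ^^ k) f x\<bar>"
      by (simp add: abs_mult power_abs)
    also have "\<dots> \<le> \<bar>t\<bar> ^ k / fact k * ((2 * M) ^ k * K)"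
      by (intro mult_left_mono formal_laplacian_power_sup_le f) auto
    finally show ?thesis by (simp add: power_mult_distrib mult_ac)
  qed
  have sz: "summable (\<lambda>k. ?z ^ k / fact k * K)"
    by (intro summable_mult2 summable_exp_real)
  have s: "summable (\<lambda>k. exp_term t f k x)"
    by (rule summable_comparison_test'[OF sz]) (use le in auto)
  have sa: "summable (\<lambda>k. \<bar>exp_term t f (k + n) x\<bar>)"
    by (rule summable_comparison_test'[OF summable_ignore_initial_segment[OF sz, of n]]) (use le in simp)
  have "\<bar>operator_exp L t f x - (\<Sum>k<n. exp_term t f k x)\<bar> = \<bar>\<Sum>k. exp_term t f (k + n) x\<bar>"
    unfolding operator_exp_def using suminf_minus_initial_segment[OF s, of n] by simp
  also have "\<dots> \<le> (\<Sum>k. \<bar>exp_term t f (k + n) x\<bar>)"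
    by (rule summable_rabs[OF sa])
  also have "\<dots> \<le> (\<Sum>k. ?z ^ (k + n) / fact (k + n) * K)"
    by (rule suminf_le[OF le sa summable_ignore_initial_segment[OF sz, of n]])
  also have "\<dots> = (\<Sum>k. ?z ^ (k + n) / fact (k + n)) * K"
    by (rule suminf_mult2[symmetric]) (rule summable_ignore_initial_segment[OF summable_exp_real])
  also have "(\<Sum>k. ?z ^ (k + n) / fact (k + n)) = exp ?z - (\<Sum>k<n. ?z ^ k / fact k)"
    using suminf_minus_initial_segment[OF summable_exp_real[of ?z], of n]
    by (simp add: exp_def field_simps)
  finally show ?thesis .
qed

lemma operator_exp_sup_le:
  assumes "\<And>x. \<bar>f x\<bar> \<le> K"
  shows "\<bar>operator_exp L t f x\<bar> \<le> exp (2 * M * \<bar>t\<bar>) * K"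
  using operator_exp_sup_remainder[of f K t x 0] assms by simp

lemma Cc_bounded:
  fixes f :: "'v \<Rightarrow> real"
  assumes "f \<in> Cc"
  obtains K where "\<And>x. \<bar>f x\<bar> \<le> K"
proof -
  have "finite (range f)"
  proof (rule finite_subset)
    show "range f \<subseteq> insert 0 (f ` {x. f x \<noteq> 0})" by auto
  qed (use assms in \<open>simp add: Cc_def\<close>)
  then have "finite ((\<lambda>x. \<bar>f x\<bar>) ` UNIV)"
    using finite_imageI[of "range f" abs] by (simp add: image_image)
  then have "\<bar>f x\<bar> \<le> Max (range (\<lambda>x. \<bar>f x\<bar>))" for x by simp
  with that show thesis by blast
qed

text \<open>The exponential series converges uniformly, and its partial sums are finitely supported.\<close>

lemma operator_exp_Cc_C0:
  assumes f: "f \<in> Cc"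
  shows "operator_exp L t f \<in> C0"
  unfolding C0_def mem_Collect_eq
proof (intro allI impI)
  fix \<epsilon> :: real assume \<epsilon>: "0 < \<epsilon>"
  obtain K where K: "\<And>x. \<bar>f x\<bar> \<le> K" using Cc_bounded[OF f] by blast
  let ?z = "2 * M * \<bar>t\<bar>"
  have "(\<lambda>n. (exp ?z - (\<Sum>k<n. ?z ^ k / fact k)) * K) \<longlonglongrightarrow> (exp ?z - exp ?z) * K"
    using summable_LIMSEQ[OF summable_exp_real[of ?z]]
    by (intro tendsto_intros) (simp add: exp_def field_simps)
  then have "\<forall>\<^sub>F n in sequentially. (exp ?z - (\<Sum>k<n. ?z ^ k / fact k)) * K < \<epsilon>"
    by (rule order_tendstoD(2)) (use \<epsilon> in simp)
  then obtain n where n: "(exp ?z - (\<Sum>k<n. ?z ^ k / fact k)) * K < \<epsilon>"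
    using eventually_happens by fastforce
  have "\<bar>operator_exp L t f x - (\<Sum>k<n. exp_term t f k x)\<bar> \<le> \<epsilon>" for x
    using operator_exp_sup_remainder[of f K t x n, OF K] n by linarith
  then show "\<exists>g\<in>Cc. \<forall>x. \<bar>operator_exp L t f x - g x\<bar> \<le> \<epsilon>"
    by (intro bexI[OF _ exp_partial_sum_Cc[OF f, of t n]]) blast
qed

lemma heat_kernel_eq:
  assumes "0 \<le> t"
  shows "heat_kernel b m t x y * m y = operator_exp L (- t) (indicator {y}) x"
  using exp_semigroup_eq_operator_exp[OF assms l2_norm_indicator(1)] m_pos[of y]
  by (simp add: heat_kernel_def laplacian_eq)

lemma operator_exp_finite_sum:
  assumes "finite F"
  shows "operator_exp L t (\<lambda>x. \<Sum>y\<in>F. c y * indicator {y} x) =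
    (\<lambda>x. \<Sum>y\<in>F. operator_exp L t (indicator {y}) x * c y)"
proof -
  have "operator_exp L t (\<lambda>x. \<Sum>y\<in>F. c y * indicator {y} x) =
      (\<lambda>x. \<Sum>y\<in>F. operator_exp L t (\<lambda>x. c y * indicator {y} x) x)"
    by (rule l2_bounded_sum[OF operator_exp_bounded assms]) (intro l2_scale l2_norm_indicator)
  moreover have "operator_exp L t (\<lambda>x. c y * indicator {y} x) =
      (\<lambda>x. c y * operator_exp L t (indicator {y}) x)" for y
    by (rule l2_bounded_simps(2)[OF operator_exp_bounded l2_norm_indicator(1)])
  ultimately show ?thesis by (simp add: mult.commute)
qed

text \<open>By duality the row sum is the value at \<open>x\<close> of the exponential applied to a finitely supported
  function with values in \<open>{-1, 0, 1}\<close>, namely the sign pattern \<open>c\<close> of the row.\<close>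

lemma operator_exp_row_sum_le:
  assumes "finite F"
  shows "(\<Sum>y\<in>F. \<bar>operator_exp L t (indicator {y}) x\<bar>) \<le> exp (2 * M * \<bar>t\<bar>)"
proof -
  define c where "c y = sgn (operator_exp L t (indicator {y}) x)" for y
  have "\<bar>\<Sum>y\<in>F. c y * indicator {y} z\<bar> \<le> 1" for z
  proof -
    have "(\<Sum>y\<in>F. c y * indicator {y} z) = (\<Sum>y\<in>F. if y = z then c y else 0)"
      by (intro sum.cong) (auto simp: indicator_def)
    also have "\<dots> = (if z \<in> F then c z else 0)"
      using assms by simp
    finally show ?thesis by (auto simp: c_def sgn_if)
  qed
  then have "\<bar>operator_exp L t (\<lambda>x. \<Sum>y\<in>F. c y * indicator {y} x) x\<bar> \<le> exp (2 * M * \<bar>t\<bar>) * 1"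
    by (rule operator_exp_sup_le)
  moreover have "operator_exp L t (\<lambda>x. \<Sum>y\<in>F. c y * indicator {y} x) x =
      (\<Sum>y\<in>F. \<bar>operator_exp L t (indicator {y}) x\<bar>)"
    unfolding operator_exp_finite_sum[OF assms] c_def by (simp add: abs_sgn)
  ultimately show ?thesis by linarith
qed

text \<open>The row sums of the kernel are bounded, which makes the sum that defines \<open>P\<^sub>t f\<close> absolutely
  convergent for bounded \<open>f\<close> and the operator \<open>P\<^sub>t\<close> continuous in the supremum norm.\<close>

lemma heat_semigroup_sup_le:
  assumes t: "0 \<le> t" and f: "\<And>x. \<bar>f x\<bar> \<le> K"
  shows "(\<lambda>y. heat_kernel b m t x y * f y * m y) summable_on UNIV"
    and "\<bar>heat_semigroup b m t f x\<bar> \<le> exp (2 * M * t) * K"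
proof -
  have K: "0 \<le> K" using f[of x] by linarith
  have le: "(\<Sum>y\<in>F. norm (heat_kernel b m t x y * f y * m y)) \<le> exp (2 * M * t) * K" if "finite F" for F
  proof -
    have "(\<Sum>y\<in>F. norm (heat_kernel b m t x y * f y * m y))
        = (\<Sum>y\<in>F. \<bar>operator_exp L (- t) (indicator {y}) x\<bar> * \<bar>f y\<bar>)"
      using heat_kernel_eq[OF t, of x]
      by (intro sum.cong) (auto simp: abs_mult[symmetric] algebra_simps)
    also have "\<dots> \<le> (\<Sum>y\<in>F. \<bar>operator_exp L (- t) (indicator {y}) x\<bar> * K)"
      by (intro sum_mono mult_left_mono f) auto
    also have "\<dots> = (\<Sum>y\<in>F. \<bar>operator_exp L (- t) (indicator {y}) x\<bar>) * K"
      by (simp add: sum_distrib_right)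
    also have "\<dots> \<le> exp (2 * M * \<bar>- t\<bar>) * K"
      by (intro mult_right_mono operator_exp_row_sum_le that K)
    finally show ?thesis using t by simp
  qed
  have abs: "(\<lambda>y. norm (heat_kernel b m t x y * f y * m y)) summable_on UNIV"
    by (rule nonneg_bdd_above_summable_on) (use le in \<open>auto intro!: bdd_aboveI2\<close>)
  then show "(\<lambda>y. heat_kernel b m t x y * f y * m y) summable_on UNIV"
    by (rule abs_summable_summable)
  have "\<bar>heat_semigroup b m t f x\<bar> \<le> (\<Sum>\<^sub>\<infinity>y. norm (heat_kernel b m t x y * f y * m y))"
    unfolding heat_semigroup_def using norm_infsum_bound[OF abs] by simp
  also have "\<dots> \<le> exp (2 * M * t) * K"
    by (rule infsum_le_finite_sums) (use abs le in auto)
  finally show "\<bar>heat_semigroup b m t f x\<bar> \<le> exp (2 * M * t) * K" .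
qed

lemma heat_semigroup_Cc:
  assumes t: "0 \<le> t" and f: "f \<in> Cc"
  shows "heat_semigroup b m t f = operator_exp L (- t) f"
proof
  fix x
  let ?S = "{y. f y \<noteq> 0}"
  have fin: "finite ?S" using f by (simp add: Cc_def)
  have "heat_semigroup b m t f x = (\<Sum>\<^sub>\<infinity>y\<in>?S. heat_kernel b m t x y * f y * m y)"
    unfolding heat_semigroup_def by (rule infsum_cong_neutral) auto
  also have "\<dots> = (\<Sum>y\<in>?S. operator_exp L (- t) (indicator {y}) x * f y)"
    using fin by (simp add: heat_kernel_eq[OF t, symmetric] mult_ac)
  also have "\<dots> = operator_exp L (- t) f x"
    using operator_exp_finite_sum[OF fin, of "- t" f] Cc_sum_indicator[OF f] by simp
  finally show "heat_semigroup b m t f x = operator_exp L (- t) f x" .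
qed

text \<open>Finitely supported functions are dense in \<open>C0\<close>, and \<open>P\<^sub>t\<close> is continuous in the supremum norm;
  so it suffices that \<open>P\<^sub>t\<close> maps \<open>Cc\<close> into \<open>C0\<close>.\<close>

theorem feller: "feller b m"
  unfolding feller_def
proof (intro allI impI ballI)
  fix t :: real and f :: "'v \<Rightarrow> real"
  assume t: "0 \<le> t" and f: "f \<in> C0"
  show "heat_semigroup b m t f \<in> C0"
    unfolding C0_def mem_Collect_eq
  proof (intro allI impI)
    fix \<epsilon> :: real assume \<epsilon>: "0 < \<epsilon>"
    define \<delta> where "\<delta> = \<epsilon> / 2 / exp (2 * M * t)"
    have "0 < \<delta>" using \<epsilon> by (simp add: \<delta>_def)
    then obtain g where g: "g \<in> Cc" "\<And>x. \<bar>f x - g x\<bar> \<le> \<delta>"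
      using f unfolding C0_def by blast
    obtain K where K: "\<And>x. \<bar>g x\<bar> \<le> K" using Cc_bounded[OF g(1)] by blast
    have s1: "(\<lambda>y. heat_kernel b m t x y * (f y - g y) * m y) summable_on UNIV" for x
      by (rule heat_semigroup_sup_le(1)[OF t]) (rule g(2))
    have s2: "(\<lambda>y. heat_kernel b m t x y * g y * m y) summable_on UNIV" for x
      by (rule heat_semigroup_sup_le(1)[OF t]) (rule K)
    have split: "heat_semigroup b m t f x = heat_semigroup b m t (\<lambda>x. f x - g x) x + heat_semigroup b m t g x" for x
      unfolding heat_semigroup_def
      using infsum_add[OF s1 s2, of x x]
      by (simp add: algebra_simps)
    have near: "\<bar>heat_semigroup b m t f x - heat_semigroup b m t g x\<bar> \<le> \<epsilon> / 2" for x
      using heat_semigroup_sup_le(2)[of t "\<lambda>x. f x - g x" \<delta> x, OF t g(2)] by (simp add: split \<delta>_def)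
    obtain h where h: "h \<in> Cc" "\<And>x. \<bar>heat_semigroup b m t g x - h x\<bar> \<le> \<epsilon> / 2"
    proof -
      have "0 < \<epsilon> / 2" using \<epsilon> by simp
      then show ?thesis
        using operator_exp_Cc_C0[OF g(1), of "- t"] that
        unfolding heat_semigroup_Cc[OF t g(1)] C0_def by blast
    qed
    have "\<bar>heat_semigroup b m t f x - h x\<bar> \<le> \<epsilon>" for x
      using near[of x] h(2)[of x] by linarith
    with h(1) show "\<exists>h\<in>Cc. \<forall>x. \<bar>heat_semigroup b m t f x - h x\<bar> \<le> \<epsilon>" by blast
  qed
qed

end

theorem corollary4p4:
  fixes b :: "'v \<Rightarrow> 'v \<Rightarrow> real" and m :: "'v \<Rightarrow> real"
  assumes "weighted_graph b m"
    and "connected_graph b"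
    and "bounded_l2_operator m (laplacian b m)"
  shows "feller b m"
proof -
  interpret graph b m
    by unfold_locales (rule assms(1))
  obtain C where C: "\<And>f h. (f, h) \<in> laplacian b m \<Longrightarrow> l2_norm m h \<le> C * l2_norm m f"
    and dom: "Domain (laplacian b m) = l2 m"
    using assms(3) unfolding bounded_l2_operator_def by blast
  \<comment> \<open>The absolute value makes the constant visibly nonnegative.\<close>
  interpret bounded_graph b m "\<bar>C\<bar>"
  proof
    fix f h assume fh: "(f, h) \<in> laplacian b m"
    then have "f \<in> l2 m" using dom by blast
    then have "C * l2_norm m f \<le> \<bar>C\<bar> * l2_norm m f"
      by (intro mult_right_mono l2_norm_nonneg) auto
    with C[OF fh] show "l2_norm m h \<le> \<bar>C\<bar> * l2_norm m f" by linarith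
  qed (use dom in auto)
  show ?thesis by (rule feller)
qed

end
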